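(* Let $q\in k$. Let $U$ be the grading of $\mathcal{B}_q$ by the infinite cyclic group $T=\langle t\rangle$ for which $\alpha$, $\beta$ and $\delta$ are homogeneous of trivial degree while $\gamma-q\beta\alpha$ is homogeneous of degree $t$ (this is induced by the corresponding grading of $kQ$, for which the ideal $I_q$ is homogeneous). Then the grading $U$ of $\mathcal{B}_q$ is universal.
   Context: Let $k$ be a field. Let $Q$ be the quiver with vertices $x,y,z,z'$ and arrows $\alpha:x\to y$, $\beta:y\to z$, $\gamma:x\to z$, $\delta:z\to z'$, and let $kQ$ be the $k$-linearization of its path category. For $q\in k$ let $I_q=k(\delta\gamma-q\delta\beta\alpha)$, a two-sided ideal of $kQ$, and let $\mathcal{B}_q=kQ/I_q$. A $k$-category is a small category $\mathcal{B}$ whose morphism sets are $k$-vector spaces and whose composition is bilinear. Its set of objects is $\mathcal{B}_0$, and ${}_{b'}\mathcal{B}_b$ is the space of morphisms with source $b$ and target $b'$. A grading $X$ of $\mathcal{B}$ by a group $\Gamma(X)$ (its structural group) is a direct sum decomposition ${}_{b'}\mathcal{B}_b=\bigoplus_{s\in\Gamma(X)}X^s{}_{b'}\mathcal{B}_b$ for all objects $b,b'$, with $(X^t{}_{b''}\mathcal{B}_{b'})(X^s{}_{b'}\mathcal{B}_b)\subset X^{ts}{}_{b''}\mathcal{B}_b$. A non-zero $f\in X^s{}_{b'}\mathcal{B}_b$ is called $X$-homogeneous of degree $\deg_X f=s$. A virtual morphism is a pair $(f,\epsilon)$ with $f$ a non-zero morphism and $\epsilon=\pm1$; $(f,1)$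 has the source and target of $f$, and for $(f,-1)$ they are reversed. A walk from $b$ to $b'$ is a sequence $w=(f_n,\epsilon_n),\dots,(f_1,\epsilon_1)$ of virtual morphisms such that the source of $(f_1,\epsilon_1)$ is $b$, the target of each $(f_i,\epsilon_i)$ is the source of $(f_{i+1},\epsilon_{i+1})$, and the target of $(f_n,\epsilon_n)$ is $b'$. It is $X$-homogeneous if all $f_i$ are, and then $\deg_X w=(\deg_X f_n)^{\epsilon_n}\cdots(\deg_X f_1)^{\epsilon_1}$. The set of $X$-homogeneous walks from $b$ to $b'$ is ${}_{b'}HW(\mathcal{B},X)_b$. The grading $X$ is connected if $\deg_X:{}_{b'}HW(\mathcal{B},X)_b\to\Gamma(X)$ is surjective for any objects $b,b'$. For gradings $X,Y$, a $k$-linear automorphism functor $J$ of $\mathcal{B}$ is homogeneous from $X$ to $Y$ if it is the identity on objects and sends $X$-homogeneous morphisms to $Y$-homogeneous morphisms. It induces $HW(J):{}_{b'}HW(\mathcal{B},X)_b\to{}_{b'}HW(\mathcal{B},Y)_b$ by applying $J$ to each $f_i$. For connected gradings $X,Y$ of a connected $k$-category with base object $b_0$, a morphism of gradings $\mu:X\to Y$ is a group map $\mu:\Gamma(X)\to\Gamma(Y)$ for which there exists a (not necessarily unique) homogeneous automorphism $J$ from $X$ to $Y$ with $\mu\circ\deg_X=\deg_Y\circ HW(J)$ on ${}_{b_0}HW(\mathcal{B},X)_{b_0}$. A connected grading $U$ is universal if for any connected grading $X$ there is a unique morphism of gradings $U\to X$. For $\mathcal{B}_q$ the base object is $b_0=x$.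 *)

theory Defs
  imports
    "HOL-Algebra.Module"
    "HOL-Algebra.AbelCoset"
    "HOL-Algebra.Generated_Groups"
    "Graph_Theory.Arc_Walk"
begin

section \<open>Categories enriched in vector spaces\<close>

text \<open>
  \<open>homs B b b'\<close> is the space of morphisms with source \<open>b\<close> and target \<open>b'\<close>, and
  \<open>cmp B b b' b'' g f\<close> is the composite of \<open>f\<close> (from \<open>b\<close> to \<open>b'\<close>) followed by \<open>g\<close> (from \<open>b'\<close>
  to \<open>b''\<close>). The carriers of different morphism spaces may overlap, so a morphism is always
  given together with its source and target. The multiplicative fields of the records
  \<open>homs B b b'\<close> are never used.
\<close>

record ('k, 'o, 'm) kcat =
  objs :: "'o set"
  homs :: "'o \<Rightarrow> 'o \<Rightarrow> ('k, 'm) module"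
  cmp :: "'o \<Rightarrow> 'o \<Rightarrow> 'o \<Rightarrow> 'm \<Rightarrow> 'm \<Rightarrow> 'm"
  idm :: "'o \<Rightarrow> 'm"

locale k_category = field K
  for K :: "('k, 'c) ring_scheme" (structure) +
  fixes B :: "('k, 'o, 'm) kcat"
  assumes homs_module:
      "\<lbrakk>b \<in> objs B; b' \<in> objs B\<rbrakk> \<Longrightarrow> Module.module K (homs B b b')"
    and idm_closed:
      "b \<in> objs B \<Longrightarrow> idm B b \<in> carrier (homs B b b)"
    and cmp_closed:
      "\<lbrakk>b \<in> objs B; b' \<in> objs B; b'' \<in> objs B;
        g \<in> carrier (homs B b' b''); f \<in> carrier (homs B b b')\<rbrakk>
       \<Longrightarrow> cmp B b b' b'' g f \<in> carrier (homs B b b'')"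
    and cmp_idm_left:
      "\<lbrakk>b \<in> objs B; b' \<in> objs B; f \<in> carrier (homs B b b')\<rbrakk>
       \<Longrightarrow> cmp B b b' b' (idm B b') f = f"
    and cmp_idm_right:
      "\<lbrakk>b \<in> objs B; b' \<in> objs B; f \<in> carrier (homs B b b')\<rbrakk>
       \<Longrightarrow> cmp B b b b' f (idm B b) = f"
    and cmp_assoc:
      "\<lbrakk>b \<in> objs B; b' \<in> objs B; b'' \<in> objs B; b''' \<in> objs B;
        h \<in> carrier (homs B b'' b'''); g \<in> carrier (homs B b' b''); f \<in> carrier (homs B b b')\<rbrakk>
       \<Longrightarrow> cmp B b b'' b''' h (cmp B b b' b'' g f) = cmp B b b' b''' (cmp B b' b'' b''' h g) f"
    and cmp_add_left:
      "\<lbrakk>b \<in> objs B; b' \<in> objs B; b'' \<in> objs B; g \<in> carrier (homs B b' b'');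
        g' \<in> carrier (homs B b' b''); f \<in> carrier (homs B b b')\<rbrakk>
       \<Longrightarrow> cmp B b b' b'' (g \<oplus>\<^bsub>homs B b' b''\<^esub> g') f
           = cmp B b b' b'' g f \<oplus>\<^bsub>homs B b b''\<^esub> cmp B b b' b'' g' f"
    and cmp_add_right:
      "\<lbrakk>b \<in> objs B; b' \<in> objs B; b'' \<in> objs B; g \<in> carrier (homs B b' b'');
        f \<in> carrier (homs B b b'); f' \<in> carrier (homs B b b')\<rbrakk>
       \<Longrightarrow> cmp B b b' b'' g (f \<oplus>\<^bsub>homs B b b'\<^esub> f')
           = cmp B b b' b'' g f \<oplus>\<^bsub>homs B b b''\<^esub> cmp B b b' b'' g f'"
    and cmp_smult_left:
      "\<lbrakk>b \<in> objs B; b' \<in> objs B; b'' \<in> objs B; c \<in> carrier K;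
        g \<in> carrier (homs B b' b''); f \<in> carrier (homs B b b')\<rbrakk>
       \<Longrightarrow> cmp B b b' b'' (c \<odot>\<^bsub>homs B b' b''\<^esub> g) f = c \<odot>\<^bsub>homs B b b''\<^esub> cmp B b b' b'' g f"
    and cmp_smult_right:
      "\<lbrakk>b \<in> objs B; b' \<in> objs B; b'' \<in> objs B; c \<in> carrier K;
        g \<in> carrier (homs B b' b''); f \<in> carrier (homs B b b')\<rbrakk>
       \<Longrightarrow> cmp B b b' b'' g (c \<odot>\<^bsub>homs B b b'\<^esub> f) = c \<odot>\<^bsub>homs B b b''\<^esub> cmp B b b' b'' g f"


section \<open>Gradings\<close>

definition is_direct_sum ::
  "('k, 'c) ring_scheme \<Rightarrow> ('k, 'm) module \<Rightarrow> 's set \<Rightarrow> ('s \<Rightarrow> 'm set) \<Rightarrow> bool" where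
  "is_direct_sum K M S V \<longleftrightarrow>
     (\<forall>s\<in>S. submodule (V s) K M) \<and>
     (\<forall>f\<in>carrier M. \<exists>!c. c \<in> (\<Pi>\<^sub>E s\<in>S. V s) \<and> finite {s\<in>S. c s \<noteq> \<zero>\<^bsub>M\<^esub>} \<and>
        f = (\<Oplus>\<^bsub>M\<^esub>s\<in>{s\<in>S. c s \<noteq> \<zero>\<^bsub>M\<^esub>}. c s))"

text \<open>
  A grading consists of its structural group and its homogeneous pieces; \<open>piece X s b b'\<close> is the
  space of morphisms of degree \<open>s\<close> from \<open>b\<close> to \<open>b'\<close>.
\<close>

record ('g, 'o, 'm) grading =
  sgroup :: "'g monoid"
  piece :: "'g \<Rightarrow> 'o \<Rightarrow> 'o \<Rightarrow> 'm set"

locale k_grading = k_category K B + group "sgroup X"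
  for K :: "('k, 'c) ring_scheme" (structure)
    and B :: "('k, 'o, 'm) kcat"
    and X :: "('g, 'o, 'm) grading" +
  assumes piece_direct_sum:
      "\<lbrakk>b \<in> objs B; b' \<in> objs B\<rbrakk>
       \<Longrightarrow> is_direct_sum K (homs B b b') (carrier (sgroup X)) (\<lambda>s. piece X s b b')"
    and piece_cmp:
      "\<lbrakk>b \<in> objs B; b' \<in> objs B; b'' \<in> objs B; s \<in> carrier (sgroup X); t \<in> carrier (sgroup X);
        g \<in> piece X t b' b''; f \<in> piece X s b b'\<rbrakk>
       \<Longrightarrow> cmp B b b' b'' g f \<in> piece X (t \<otimes>\<^bsub>sgroup X\<^esub> s) b b''"

definition homogeneous_of_degree ::
  "('k, 'o, 'm) kcat \<Rightarrow> ('g, 'o, 'm) grading \<Rightarrow> 'o \<Rightarrow> 'o \<Rightarrow> 'm \<Rightarrow> 'g \<Rightarrow> bool" where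
  "homogeneous_of_degree B X b b' f s \<longleftrightarrow>
     f \<noteq> \<zero>\<^bsub>homs B b b'\<^esub> \<and> s \<in> carrier (sgroup X) \<and> f \<in> piece X s b b'"

definition homogeneous ::
  "('k, 'o, 'm) kcat \<Rightarrow> ('g, 'o, 'm) grading \<Rightarrow> 'o \<Rightarrow> 'o \<Rightarrow> 'm \<Rightarrow> bool" where
  "homogeneous B X b b' f \<longleftrightarrow> (\<exists>s. homogeneous_of_degree B X b b' f s)"

definition degree ::
  "('k, 'o, 'm) kcat \<Rightarrow> ('g, 'o, 'm) grading \<Rightarrow> 'o \<Rightarrow> 'o \<Rightarrow> 'm \<Rightarrow> 'g" where
  "degree B X b b' f = (THE s. homogeneous_of_degree B X b b' f s)"


section \<open>Walks\<close>

text \<open>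
  A virtual morphism \<open>(b, b', f, \<epsilon>)\<close> consists of a morphism \<open>f\<close> with its own source \<open>b\<close> and
  target \<open>b'\<close>, and a sign.
\<close>

type_synonym ('o, 'm) vmor = "'o \<times> 'o \<times> 'm \<times> int"

fun vmor_ok :: "('k, 'o, 'm) kcat \<Rightarrow> ('o, 'm) vmor \<Rightarrow> bool" where
  "vmor_ok B (b, b', f, e) \<longleftrightarrow>
     b \<in> objs B \<and> b' \<in> objs B \<and> f \<in> carrier (homs B b b') \<and> f \<noteq> \<zero>\<^bsub>homs B b b'\<^esub> \<and> e \<in> {1, -1}"

fun vsrc :: "('o, 'm) vmor \<Rightarrow> 'o" where
  "vsrc (b, b', f, e) = (if e = 1 then b else b')"

fun vtgt :: "('o, 'm) vmor \<Rightarrow> 'o" where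
  "vtgt (b, b', f, e) = (if e = 1 then b' else b)"

fun vhomogeneous :: "('k, 'o, 'm) kcat \<Rightarrow> ('g, 'o, 'm) grading \<Rightarrow> ('o, 'm) vmor \<Rightarrow> bool" where
  "vhomogeneous B X (b, b', f, e) \<longleftrightarrow> homogeneous B X b b' f"

fun vdegree :: "('k, 'o, 'm) kcat \<Rightarrow> ('g, 'o, 'm) grading \<Rightarrow> ('o, 'm) vmor \<Rightarrow> 'g" where
  "vdegree B X (b, b', f, e) = degree B X b b' f [^]\<^bsub>sgroup X\<^esub> e"

text \<open>
  A walk is the list of its virtual morphisms in the order of composition: the head of the list
  comes last in the walk.
\<close>

definition walks :: "('k, 'o, 'm) kcat \<Rightarrow> 'o \<Rightarrow> 'o \<Rightarrow> ('o, 'm) vmor list set" where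
  "walks B b b' =
     {w. w \<noteq> [] \<and> (\<forall>v\<in>set w. vmor_ok B v) \<and> vsrc (last w) = b \<and> vtgt (hd w) = b' \<and>
         successively (\<lambda>v u. vtgt u = vsrc v) w}"

definition HW ::
  "('k, 'o, 'm) kcat \<Rightarrow> ('g, 'o, 'm) grading \<Rightarrow> 'o \<Rightarrow> 'o \<Rightarrow> ('o, 'm) vmor list set" where
  "HW B X b b' = {w \<in> walks B b b'. \<forall>v\<in>set w. vhomogeneous B X v}"

definition walk_degree ::
  "('k, 'o, 'm) kcat \<Rightarrow> ('g, 'o, 'm) grading \<Rightarrow> ('o, 'm) vmor list \<Rightarrow> 'g" where
  "walk_degree B X w = foldr (\<lambda>v d. vdegree B X v \<otimes>\<^bsub>sgroup X\<^esub> d) w \<one>\<^bsub>sgroup X\<^esub>"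

text \<open>If a connected grading exists, then the category itself is connected.\<close>

locale connected_k_grading = k_grading +
  assumes walk_degree_surj:
    "\<lbrakk>b \<in> objs B; b' \<in> objs B\<rbrakk> \<Longrightarrow> carrier (sgroup X) \<subseteq> walk_degree B X ` HW B X b b'"


section \<open>Morphisms of gradings and universal gradings\<close>

text \<open>
  An automorphism functor which is the identity on objects is given by its action
  \<open>J b b'\<close> on each morphism space.
\<close>

locale k_automorphism = k_category K B
  for K :: "('k, 'c) ring_scheme" (structure) and B :: "('k, 'o, 'm) kcat" +
  fixes J :: "'o \<Rightarrow> 'o \<Rightarrow> 'm \<Rightarrow> 'm"
  assumes J_bij:
      "\<lbrakk>b \<in> objs B; b' \<in> objs B\<rbrakk>
       \<Longrightarrow> bij_betw (J b b') (carrier (homs B b b')) (carrier (homs B b b'))"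
    and J_add:
      "\<lbrakk>b \<in> objs B; b' \<in> objs B; f \<in> carrier (homs B b b'); g \<in> carrier (homs B b b')\<rbrakk>
       \<Longrightarrow> J b b' (f \<oplus>\<^bsub>homs B b b'\<^esub> g) = J b b' f \<oplus>\<^bsub>homs B b b'\<^esub> J b b' g"
    and J_smult:
      "\<lbrakk>b \<in> objs B; b' \<in> objs B; c \<in> carrier K; f \<in> carrier (homs B b b')\<rbrakk>
       \<Longrightarrow> J b b' (c \<odot>\<^bsub>homs B b b'\<^esub> f) = c \<odot>\<^bsub>homs B b b'\<^esub> J b b' f"
    and J_idm: "b \<in> objs B \<Longrightarrow> J b b (idm B b) = idm B b"
    and J_cmp:
      "\<lbrakk>b \<in> objs B; b' \<in> objs B; b'' \<in> objs B;
        g \<in> carrier (homs B b' b''); f \<in> carrier (homs B b b')\<rbrakk>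
       \<Longrightarrow> J b b'' (cmp B b b' b'' g f) = cmp B b b' b'' (J b' b'' g) (J b b' f)"

definition homogeneous_automorphism ::
  "('k, 'c) ring_scheme \<Rightarrow> ('k, 'o, 'm) kcat \<Rightarrow> ('g, 'o, 'm) grading \<Rightarrow> ('h, 'o, 'm) grading
   \<Rightarrow> ('o \<Rightarrow> 'o \<Rightarrow> 'm \<Rightarrow> 'm) \<Rightarrow> bool" where
  "homogeneous_automorphism K B X Y J \<longleftrightarrow>
     k_automorphism K B J \<and>
     (\<forall>b\<in>objs B. \<forall>b'\<in>objs B. \<forall>f. homogeneous B X b b' f \<longrightarrow> homogeneous B Y b b' (J b b' f))"

definition map_walk :: "('o \<Rightarrow> 'o \<Rightarrow> 'm \<Rightarrow> 'm) \<Rightarrow> ('o, 'm) vmor list \<Rightarrow> ('o, 'm) vmor list" where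
  "map_walk J w = map (\<lambda>(b, b', f, e). (b, b', J b b' f, e)) w"

definition grading_morphism ::
  "('k, 'c) ring_scheme \<Rightarrow> ('k, 'o, 'm) kcat \<Rightarrow> 'o \<Rightarrow> ('g, 'o, 'm) grading \<Rightarrow> ('h, 'o, 'm) grading
   \<Rightarrow> ('g \<Rightarrow> 'h) \<Rightarrow> bool" where
  "grading_morphism K B b0 X Y \<mu> \<longleftrightarrow>
     \<mu> \<in> hom (sgroup X) (sgroup Y) \<and>
     (\<exists>J. homogeneous_automorphism K B X Y J \<and>
          (\<forall>w\<in>HW B X b0 b0. \<mu> (walk_degree B X w) = walk_degree B Y (map_walk J w)))"

text \<open>
  Group maps are identified with functions that are \<^const>\<open>extensional\<close> on the carrier, so that
  uniqueness only concerns their values on the group. The argument of type \<open>'g itself\<close> is the type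
  whose elements make up the structural groups of the gradings that \<open>U\<close> is compared with; a theorem
  that is polymorphic in \<open>'g\<close> is about all structural groups.
\<close>

definition universal_grading ::
  "'g itself \<Rightarrow> ('k, 'c) ring_scheme \<Rightarrow> ('k, 'o, 'm) kcat \<Rightarrow> 'o \<Rightarrow> ('u, 'o, 'm) grading \<Rightarrow> bool" where
  "universal_grading _ K B b0 U \<longleftrightarrow>
     connected_k_grading K B U \<and>
     (\<forall>X :: ('g, 'o, 'm) grading. connected_k_grading K B X \<longrightarrow>
        (\<exists>!\<mu>. \<mu> \<in> extensional (carrier (sgroup U)) \<and> grading_morphism K B b0 U X \<mu>))"


section \<open>Linearized path categories and quotients\<close>

text \<open>
  A path is a list of arrows in the order in which they are traversed, so the composite of
  \<open>p\<close> followed by \<open>r\<close> is \<open>p @ r\<close>. A morphism of the linearization is a formal linear combination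
  of paths, i.e. a finitely supported function. Since the pairs \<open>(p, p')\<close> with \<open>p @ p' = r\<close> are
  the pairs \<open>(take i r, drop i r)\<close> with \<open>i \<le> length r\<close>, the bilinear extension of concatenation is
  the convolution below.
\<close>

definition paths :: "('v, 'a) pre_digraph \<Rightarrow> 'v \<Rightarrow> 'v \<Rightarrow> 'a list set" where
  "paths Q b b' = {p. pre_digraph.awalk Q b p b'}"

definition path_kcat ::
  "('k, 'c) ring_scheme \<Rightarrow> ('v, 'a) pre_digraph \<Rightarrow> ('k, 'v, 'a list \<Rightarrow> 'k) kcat" where
  "path_kcat K Q =
    \<lparr>objs = verts Q,
     homs = (\<lambda>b b'.
       \<lparr>carrier = {f. range f \<subseteq> carrier K \<and> finite {p. f p \<noteq> \<zero>\<^bsub>K\<^esub>} \<and>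
                      {p. f p \<noteq> \<zero>\<^bsub>K\<^esub>} \<subseteq> paths Q b b'},
        mult = undefined, one = undefined,
        zero = (\<lambda>p. \<zero>\<^bsub>K\<^esub>),
        add = (\<lambda>f g p. f p \<oplus>\<^bsub>K\<^esub> g p),
        smult = (\<lambda>c f p. c \<otimes>\<^bsub>K\<^esub> f p)\<rparr>),
     cmp = (\<lambda>b b' b'' g f r.
       \<Oplus>\<^bsub>K\<^esub>i\<in>{..length r}. g (drop i r) \<otimes>\<^bsub>K\<^esub> f (take i r)),
     idm = (\<lambda>b p. if p = [] then \<one>\<^bsub>K\<^esub> else \<zero>\<^bsub>K\<^esub>)\<rparr>"

definition path_vec :: "('k, 'c) ring_scheme \<Rightarrow> 'a list \<Rightarrow> 'a list \<Rightarrow> 'k" where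
  "path_vec K p = (\<lambda>r. if r = p then \<one>\<^bsub>K\<^esub> else \<zero>\<^bsub>K\<^esub>)"

text \<open>The quotient by a two-sided ideal, given by its subspaces \<open>I b b'\<close> of the morphism spaces.\<close>

definition quotient_kcat ::
  "('k, 'o, 'm) kcat \<Rightarrow> ('o \<Rightarrow> 'o \<Rightarrow> 'm set) \<Rightarrow> ('k, 'o, 'm set) kcat" where
  "quotient_kcat B I =
    \<lparr>objs = objs B,
     homs = (\<lambda>b b'.
       \<lparr>carrier = a_rcosets\<^bsub>homs B b b'\<^esub> (I b b'),
        mult = undefined, one = undefined,
        zero = I b b',
        add = set_add (homs B b b'),
        smult = (\<lambda>c F. \<Union>f\<in>F. I b b' +>\<^bsub>homs B b b'\<^esub> (c \<odot>\<^bsub>homs B b b'\<^esub> f))\<rparr>),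
     cmp = (\<lambda>b b' b'' G F.
       \<Union>g\<in>G. \<Union>f\<in>F. I b b'' +>\<^bsub>homs B b b''\<^esub> cmp B b b' b'' g f),
     idm = (\<lambda>b. I b b +>\<^bsub>homs B b b\<^esub> idm B b)\<rparr>"


section \<open>The categories \<open>\<B>\<^sub>q\<close>\<close>

datatype vertex = Vx | Vy | Vz | Vz'

datatype arrow = Alpha | Beta | Gamma | Delta

definition Qv :: "(vertex, arrow) pre_digraph" where
  "Qv = \<lparr>verts = UNIV, arcs = UNIV,
         tail = case_arrow Vx Vy Vx Vz,
         head = case_arrow Vy Vz Vz Vz'\<rparr>"

definition I_rel ::
  "('k, 'c) ring_scheme \<Rightarrow> 'k \<Rightarrow> vertex \<Rightarrow> vertex \<Rightarrow> (arrow list \<Rightarrow> 'k) set" where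
  "I_rel K q b b' =
    (let M = homs (path_kcat K Qv) b b' in
     if b = Vx \<and> b' = Vz'
     then {c \<odot>\<^bsub>M\<^esub> (path_vec K [Gamma, Delta] \<ominus>\<^bsub>M\<^esub> q \<odot>\<^bsub>M\<^esub> path_vec K [Alpha, Beta, Delta])
           | c. c \<in> carrier K}
     else {\<zero>\<^bsub>M\<^esub>})"

definition B_cat ::
  "('k, 'c) ring_scheme \<Rightarrow> 'k \<Rightarrow> ('k, vertex, (arrow list \<Rightarrow> 'k) set) kcat" where
  "B_cat K q = quotient_kcat (path_kcat K Qv) (I_rel K q)"

definition arrow_mor ::
  "('k, 'c) ring_scheme \<Rightarrow> 'k \<Rightarrow> arrow \<Rightarrow> (arrow list \<Rightarrow> 'k) set" where
  "arrow_mor K q a =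
    I_rel K q (tail Qv a) (head Qv a) +>\<^bsub>homs (path_kcat K Qv) (tail Qv a) (head Qv a)\<^esub> path_vec K [a]"

definition special_grading ::
  "('k, 'c) ring_scheme \<Rightarrow> 'k \<Rightarrow> 't monoid \<Rightarrow> 't
   \<Rightarrow> ('t, vertex, (arrow list \<Rightarrow> 'k) set) grading \<Rightarrow> bool" where
  "special_grading K q T t U \<longleftrightarrow>
    (let B = B_cat K q; M = homs B Vx Vz in
     k_grading K B U \<and> sgroup U = T \<and>
     homogeneous_of_degree B U Vx Vy (arrow_mor K q Alpha) \<one>\<^bsub>T\<^esub> \<and>
     homogeneous_of_degree B U Vy Vz (arrow_mor K q Beta) \<one>\<^bsub>T\<^esub> \<and>
     homogeneous_of_degree B U Vz Vz' (arrow_mor K q Delta) \<one>\<^bsub>T\<^esub> \<and>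
     homogeneous_of_degree B U Vx Vz
       (arrow_mor K q Gamma \<ominus>\<^bsub>M\<^esub>
        q \<odot>\<^bsub>M\<^esub> cmp B Vx Vy Vz (arrow_mor K q Beta) (arrow_mor K q Alpha)) t)"

end

theory Submission
  imports Defs "HOL-Algebra.Multiplicative_Group"
begin

text \<open>
  In \<open>\<B>\<^sub>q\<close> put \<open>\<gamma>' = \<gamma> - q\<beta>\<alpha>\<close>. The relation says that \<open>\<delta>\<gamma>' = 0\<close>, whereas \<open>\<delta>\<beta>\<alpha> \<noteq> 0\<close>. So \<open>\<beta>\<alpha>\<close> and \<open>\<gamma>'\<close> form
  a basis of the morphisms from \<open>x\<close> to \<open>z\<close>, the line of \<open>\<gamma>'\<close> is the kernel of composition with \<open>\<delta>\<close>, and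
  all other morphism spaces have dimension at most one. The parameter \<open>q\<close> is no longer visible in this
  description, which is the locale \<open>triangle_with_tail\<close>; that \<open>\<B>\<^sub>q\<close> satisfies it is
  \<open>triangle_with_tail_B_cat\<close>, which rests on the facts that path categories and quotients of linear
  categories are linear categories.

  The grading \<open>U\<close> exists because \<open>\<gamma>'\<close> only composes non-trivially with scalars, so that giving it a
  degree of its own is consistent (\<open>grading_exists\<close>).

  Let \<open>X\<close> be any grading. Spanning vectors of one-dimensional spaces are homogeneous, so \<open>\<alpha>\<close>, \<open>\<beta>\<close>, \<open>\<delta>\<close> have
  degrees \<open>a\<close>, \<open>b\<close>, \<open>d\<close>, and \<open>\<gamma>'\<close> has a degree \<open>c\<close> because it spans the kernel of composition with a
  homogeneous morphism (\<open>generators_homogeneous\<close>). The closed walk \<open>\<alpha>\<^sup>-\<^sup>1\<beta>\<^sup>-\<^sup>1\<gamma>'\<close> at \<open>x\<close> has degree \<open>t\<close> in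
  \<open>U\<close> and degree \<open>m = (ba)\<^sup>-\<^sup>1c\<close> in \<open>X\<close>. An automorphism that fixes the objects rescales \<open>\<alpha>\<close>, \<open>\<beta>\<close>,
  \<open>\<gamma>'\<close>, hence does not change the degree of this walk (\<open>loop_degree\<close>). So a morphism of gradings from
  \<open>U\<close> to \<open>X\<close> must send \<open>t\<close> to \<open>m\<close>, which proves uniqueness.

  Conversely \<open>t \<mapsto> m\<close> defines a group map on the infinite cyclic group, and the identity automorphism
  realizes it: with the potential \<open>p(x) = 1\<close>, \<open>p(y) = a\<close>, \<open>p(z) = ba\<close>, \<open>p(z') = dba\<close>, a \<open>U\<close>-homogeneous
  morphism from \<open>v\<close> to \<open>v'\<close> of degree \<open>s\<close> is \<open>X\<close>-homogeneous of degree \<open>p(v') \<mu>(s) p(v)\<^sup>-\<^sup>1\<close>. Along a walk the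
  potentials telescope (\<open>walk_degree_telescope\<close>), and they cancel on walks closed at \<open>x\<close>.
\<close>

section \<open>Linearized path categories\<close>

text \<open>
  Both sides sum \<open>F\<close> over the pairs \<open>j \<le> i \<le> n\<close>. This exchange of summation is what makes the
  convolution product associative.
\<close>

lemma (in abelian_monoid) finsum_triangle:
  fixes F :: "nat \<Rightarrow> nat \<Rightarrow> 'a"
  assumes "\<And>i j. F i j \<in> carrier G"
  shows "(\<Oplus>i\<in>{..n}. \<Oplus>j\<in>{..i}. F j i) = (\<Oplus>j\<in>{..n}. \<Oplus>i\<in>{..n - j}. F j (j + i))"
proof (induction n)
  case 0
  show ?case using assms by simp
next
  case (Suc n)
  have inner: "(\<Oplus>i\<in>{..Suc n - j}. F j (j + i)) = (\<Oplus>i\<in>{..n - j}. F j (j + i)) \<oplus> F j (Suc n)"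
    if "j \<in> {..n}" for j
    using that assms by (simp add: Suc_diff_le Pi_def a_comm)
  have "(\<Oplus>i\<in>{..Suc n}. \<Oplus>j\<in>{..i}. F j i)
    = (\<Oplus>j\<in>{..n}. \<Oplus>i\<in>{..n - j}. F j (j + i)) \<oplus> ((\<Oplus>j\<in>{..n}. F j (Suc n)) \<oplus> F (Suc n) (Suc n))"
    using assms Suc by (simp add: Pi_def a_ac)
  also have "\<dots> = (\<Oplus>j\<in>{..n}. (\<Oplus>i\<in>{..n - j}. F j (j + i)) \<oplus> F j (Suc n)) \<oplus> F (Suc n) (Suc n)"
    using assms by (simp add: finsum_addf Pi_def a_ac)
  also have "(\<Oplus>j\<in>{..n}. (\<Oplus>i\<in>{..n - j}. F j (j + i)) \<oplus> F j (Suc n))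
    = (\<Oplus>j\<in>{..n}. \<Oplus>i\<in>{..Suc n - j}. F j (j + i))"
    using assms by (intro finsum_cong') (simp_all only: inner, auto simp: Pi_def)
  also have "(\<Oplus>j\<in>{..n}. \<Oplus>i\<in>{..Suc n - j}. F j (j + i)) \<oplus> F (Suc n) (Suc n)
    = (\<Oplus>j\<in>{..Suc n}. \<Oplus>i\<in>{..Suc n - j}. F j (j + i))"
  proof -
    have "(\<lambda>j. \<Oplus>i\<in>{..Suc n - j}. F j (j + i)) \<in> {..Suc n} \<rightarrow> carrier G"
      using assms by (intro Pi_I finsum_closed) blast
    note expand = finsum_Suc[OF this]
    have "(\<lambda>j. \<Oplus>i\<in>{..Suc n - j}. F j (j + i)) \<in> {..n} \<rightarrow> carrier G"
      using assms by (intro Pi_I finsum_closed) blast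
    then have "(\<Oplus>j\<in>{..n}. \<Oplus>i\<in>{..Suc n - j}. F j (j + i)) \<in> carrier G"
      by (rule finsum_closed)
    note comm = a_comm[OF this assms]
    have "(\<Oplus>i\<in>{..Suc n - Suc n}. F (Suc n) (Suc n + i)) = F (Suc n) (Suc n)"
      using assms by simp
    then show ?thesis
      unfolding expand comm by (rule arg_cong[OF sym])
  qed
  finally show ?case .
qed

lemma (in abelian_monoid) finsum_nonzeroD:
  assumes "(\<Oplus>i\<in>A. f i) \<noteq> \<zero>"
  shows "\<exists>i\<in>A. f i \<noteq> \<zero>"
proof (rule ccontr)
  assume "\<not> (\<exists>i\<in>A. f i \<noteq> \<zero>)"
  then have "(\<Oplus>i\<in>A. f i) = \<zero>"
    by (intro add.finprod_one_eqI) simp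
  with assms show False ..
qed

lemma path_kcat_sel [simp]:
  "objs (path_kcat K Q) = verts Q"
  "idm (path_kcat K Q) b = path_vec K []"
  "\<zero>\<^bsub>homs (path_kcat K Q) b b'\<^esub> = (\<lambda>p. \<zero>\<^bsub>K\<^esub>)"
  "f \<oplus>\<^bsub>homs (path_kcat K Q) b b'\<^esub> g = (\<lambda>p. f p \<oplus>\<^bsub>K\<^esub> g p)"
  "c \<odot>\<^bsub>homs (path_kcat K Q) b b'\<^esub> f = (\<lambda>p. c \<otimes>\<^bsub>K\<^esub> f p)"
  by (auto simp: path_kcat_def path_vec_def)

lemma path_kcat_carrier:
  "f \<in> carrier (homs (path_kcat K Q) b b') \<longleftrightarrow> range f \<subseteq> carrier K \<and>
     finite {p. f p \<noteq> \<zero>\<^bsub>K\<^esub>} \<and> {p. f p \<noteq> \<zero>\<^bsub>K\<^esub>} \<subseteq> paths Q b b'"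
  by (simp add: path_kcat_def)

lemma path_kcat_carrierI:
  assumes "\<And>p. f p \<in> carrier K" "finite S" "S \<subseteq> paths Q b b'" "\<And>p. p \<notin> S \<Longrightarrow> f p = \<zero>\<^bsub>K\<^esub>"
  shows "f \<in> carrier (homs (path_kcat K Q) b b')"
proof -
  have "{p. f p \<noteq> \<zero>\<^bsub>K\<^esub>} \<subseteq> S" using assms(4) by blast
  then show ?thesis
    unfolding path_kcat_carrier using assms(1-3) by (auto intro: finite_subset)
qed

lemma path_kcat_carrierD:
  assumes "f \<in> carrier (homs (path_kcat K Q) b b')"
  shows "f p \<in> carrier K" "finite {p. f p \<noteq> \<zero>\<^bsub>K\<^esub>}" "{p. f p \<noteq> \<zero>\<^bsub>K\<^esub>} \<subseteq> paths Q b b'"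
  using assms by (auto simp: path_kcat_carrier)

lemma path_kcat_cmp:
  "cmp (path_kcat K Q) b b' b'' g f
    = (\<lambda>r. \<Oplus>\<^bsub>K\<^esub>i\<in>{..length r}. g (drop i r) \<otimes>\<^bsub>K\<^esub> f (take i r))"
  by (simp add: path_kcat_def)

lemma path_kcat_homs_module:
  fixes K :: "('k, 'c) ring_scheme" (structure)
  assumes "cring K"
  shows "Module.module K (homs (path_kcat K Q) b b')"
proof -
  interpret cring K by fact
  let ?M = "homs (path_kcat K Q) b b'"
  note val = path_kcat_carrierD(1)
  have add: "(\<lambda>p. f p \<oplus> g p) \<in> carrier ?M" if f: "f \<in> carrier ?M" and g: "g \<in> carrier ?M" for f g
    by (rule path_kcat_carrierI[where S = "{p. f p \<noteq> \<zero>} \<union> {p. g p \<noteq> \<zero>}"])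
      (use path_kcat_carrierD[OF f] path_kcat_carrierD[OF g] in auto)
  have smult: "(\<lambda>p. c \<otimes> f p) \<in> carrier ?M" if c: "c \<in> carrier K" and f: "f \<in> carrier ?M" for c f
    by (rule path_kcat_carrierI[where S = "{p. f p \<noteq> \<zero>}"])
      (use c path_kcat_carrierD[OF f] in auto)
  have ab: "abelian_group ?M"
  proof (rule abelian_groupI)
    show "\<zero>\<^bsub>?M\<^esub> \<in> carrier ?M"
      by (rule path_kcat_carrierI[where S = "{}"]) auto
    show "\<exists>g\<in>carrier ?M. g \<oplus>\<^bsub>?M\<^esub> f = \<zero>\<^bsub>?M\<^esub>" if f: "f \<in> carrier ?M" for f
    proof (rule bexI)
      show "(\<lambda>p. (\<ominus> \<one>) \<otimes> f p) \<in> carrier ?M" using f by (intro smult) auto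
      show "(\<lambda>p. (\<ominus> \<one>) \<otimes> f p) \<oplus>\<^bsub>?M\<^esub> f = \<zero>\<^bsub>?M\<^esub>"
        using val[OF f] by (simp add: l_minus l_neg)
    qed
  qed (simp_all add: add val a_ac)
  show ?thesis
    by (rule moduleI[OF cring_axioms ab]) (simp_all add: smult val l_distr r_distr m_assoc)
qed

lemma path_kcat_cmp_closed:
  fixes K :: "('k, 'c) ring_scheme" (structure)
  assumes "cring K" "wf_digraph Q"
    and g: "g \<in> carrier (homs (path_kcat K Q) b' b'')"
    and f: "f \<in> carrier (homs (path_kcat K Q) b b')"
  shows "cmp (path_kcat K Q) b b' b'' g f \<in> carrier (homs (path_kcat K Q) b b'')"
proof -
  interpret cring K by fact
  interpret wf_digraph Q by fact
  note f = path_kcat_carrierD[OF f] and g = path_kcat_carrierD[OF g]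
  let ?S = "(\<lambda>(p, r). p @ r) ` ({p. f p \<noteq> \<zero>} \<times> {r. g r \<noteq> \<zero>})"
  show ?thesis
  proof (rule path_kcat_carrierI)
    show "cmp (path_kcat K Q) b b' b'' g f r \<in> carrier K" for r
      unfolding path_kcat_cmp using f(1) g(1) by (intro finsum_closed) simp
    show "finite ?S" using f(2) g(2) by blast
    show "?S \<subseteq> paths Q b b''"
      using f(3) g(3) awalk_appendI unfolding paths_def by fast
    fix r assume r: "r \<notin> ?S"
    have "g (drop i r) \<otimes> f (take i r) = \<zero>" for i
    proof -
      have "g (drop i r) = \<zero> \<or> f (take i r) = \<zero>"
      proof (rule ccontr)
        assume "\<not> ?thesis"
        then have "take i r @ drop i r \<in> ?S" by blast
        with r show False by simp
      qed
      then show ?thesis using f(1) g(1) by auto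
    qed
    then show "cmp (path_kcat K Q) b b' b'' g f r = \<zero>"
      by (simp add: path_kcat_cmp)
  qed
qed

text \<open>
  Both composites are sums over all ways to cut the path \<open>r\<close> at two places \<open>j \<le> i\<close>; they only differ
  in which cut is summed over first.
\<close>

lemma path_kcat_cmp_assoc:
  fixes K :: "('k, 'c) ring_scheme" (structure)
  assumes "cring K" and h: "range h \<subseteq> carrier K" and g: "range g \<subseteq> carrier K" and f: "range f \<subseteq> carrier K"
  shows "cmp (path_kcat K Q) b b'' b''' h (cmp (path_kcat K Q) b b' b'' g f)
    = cmp (path_kcat K Q) b b' b''' (cmp (path_kcat K Q) b' b'' b''' h g) f"
proof
  interpret cring K by fact
  fix r
  let ?F = "\<lambda>j i. h (drop i r) \<otimes> g (drop j (take i r)) \<otimes> f (take j r)"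
  have val: "f p \<in> carrier K" "g p \<in> carrier K" "h p \<in> carrier K" for p
    using f g h by auto
  have "(\<Oplus>i\<in>{..length r}. h (drop i r) \<otimes> (\<Oplus>j\<in>{..length (take i r)}. g (drop j (take i r)) \<otimes> f (take j (take i r))))
      = (\<Oplus>i\<in>{..length r}. \<Oplus>j\<in>{..i}. ?F j i)"
    using val by (intro finsum_cong') (auto simp: finsum_rdistr min_def m_assoc intro!: finsum_cong' finsum_closed)
  also have "\<dots> = (\<Oplus>j\<in>{..length r}. \<Oplus>i\<in>{..length r - j}. ?F j (j + i))"
    using val by (intro finsum_triangle) auto
  also have "\<dots> = (\<Oplus>j\<in>{..length r}. (\<Oplus>i\<in>{..length (drop j r)}. h (drop i (drop j r)) \<otimes> g (take i (drop j r))) \<otimes> f (take j r))"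
    using val by (intro finsum_cong') (auto simp: finsum_ldistr drop_take add.commute intro!: finsum_cong' finsum_closed)
  finally show "cmp (path_kcat K Q) b b'' b''' h (cmp (path_kcat K Q) b b' b'' g f) r
    = cmp (path_kcat K Q) b b' b''' (cmp (path_kcat K Q) b' b'' b''' h g) f r"
    by (simp add: path_kcat_cmp)
qed

lemma path_vec_closed:
  fixes K :: "('k, 'c) ring_scheme" (structure)
  assumes "cring K" "p \<in> paths Q b b'"
  shows "path_vec K p \<in> carrier (homs (path_kcat K Q) b b')"
proof -
  interpret cring K by fact
  show ?thesis
    by (rule path_kcat_carrierI[where S = "{p}"]) (use assms(2) in \<open>auto simp: path_vec_def\<close>)
qed

text \<open>
  Precomposition with a path \<open>p\<close> is a shift: among the cuts of \<open>r\<close> only the one after \<open>length p\<close>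
  arrows can contribute.
\<close>

lemma cmp_path_vec_right:
  fixes K :: "('k, 'c) ring_scheme" (structure)
  assumes "cring K" "range g \<subseteq> carrier K"
  shows "cmp (path_kcat K Q) b b' b'' g (path_vec K p) r
    = (if take (length p) r = p then g (drop (length p) r) else \<zero>\<^bsub>K\<^esub>)"
proof -
  interpret cring K by fact
  have val: "g p \<in> carrier K" for p using assms(2) by auto
  show ?thesis
  proof (cases "take (length p) r = p")
    case True
    then have len: "length p \<le> length r"
      by (metis length_take min.cobounded1 min.commute)
    have "(\<Oplus>i\<in>{..length r}. g (drop i r) \<otimes> path_vec K p (take i r))
        = (\<Oplus>i\<in>{..length r}. if length p = i then g (drop i r) else \<zero>)"
      using True len val by (intro finsum_cong') (auto simp: path_vec_def)
    also have "\<dots> = g (drop (length p) r)"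
      using len val by (intro finsum_singleton) auto
    finally show ?thesis using True by (simp add: path_kcat_cmp)
  next
    case False
    have "(\<Oplus>i\<in>{..length r}. g (drop i r) \<otimes> path_vec K p (take i r)) = \<zero>"
      using False val by (intro add.finprod_one_eqI) (auto simp: path_vec_def)
    with False show ?thesis by (simp add: path_kcat_cmp)
  qed
qed

lemma cmp_path_vec_path_vec:
  fixes K :: "('k, 'c) ring_scheme" (structure)
  assumes "cring K"
  shows "cmp (path_kcat K Q) b b' b'' (path_vec K r) (path_vec K p) = path_vec K (p @ r)"
proof
  interpret cring K by fact
  fix s
  have rng: "range (path_vec K r) \<subseteq> carrier K" by (auto simp: path_vec_def)
  show "cmp (path_kcat K Q) b b' b'' (path_vec K r) (path_vec K p) s = path_vec K (p @ r) s"
    unfolding cmp_path_vec_right[OF assms rng] by (auto simp: path_vec_def) (metis append_take_drop_id)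
qed

lemma path_kcat_cmp_idm_left:
  fixes K :: "('k, 'c) ring_scheme" (structure)
  assumes "cring K" "range f \<subseteq> carrier K"
  shows "cmp (path_kcat K Q) b b' b'' (path_vec K []) f = f"
proof
  interpret cring K by fact
  fix r
  have val: "f p \<in> carrier K" for p using assms(2) by auto
  have "(\<Oplus>i\<in>{..length r}. path_vec K [] (drop i r) \<otimes> f (take i r))
      = (\<Oplus>i\<in>{..length r}. if length r = i then f (take i r) else \<zero>)"
    using val by (intro finsum_cong') (auto simp: path_vec_def)
  also have "\<dots> = f (take (length r) r)"
    using val by (intro finsum_singleton) auto
  finally show "cmp (path_kcat K Q) b b' b'' (path_vec K []) f r = f r"
    by (simp add: path_kcat_cmp)
qed

lemma k_category_path_kcat:
  fixes K :: "('k, 'c) ring_scheme" (structure)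
  assumes "field K" "wf_digraph Q"
  shows "k_category K (path_kcat K Q)"
proof -
  interpret field K by fact
  interpret wf_digraph Q by fact
  note val = path_kcat_carrierD(1)
  have rng: "range f \<subseteq> carrier K" if "f \<in> carrier (homs (path_kcat K Q) b b')" for f b b'
    using val[OF that] by auto
  have fin: "(\<Oplus>i\<in>A. f i) = (\<Oplus>i\<in>A. g i) \<oplus> (\<Oplus>i\<in>A. h i)"
    if "\<And>i. f i = g i \<oplus> h i" "\<And>i. g i \<in> carrier K" "\<And>i. h i \<in> carrier K" for f g h and A :: "nat set"
    using that by (simp add: finsum_addf Pi_def)
  show ?thesis
  proof (intro k_category.intro field_axioms k_category_axioms.intro)
    show "idm (path_kcat K Q) b \<in> carrier (homs (path_kcat K Q) b b)"
      if "b \<in> objs (path_kcat K Q)" for b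
      unfolding path_kcat_sel(2) using that
      by (intro path_vec_closed[OF cring_axioms]) (simp add: paths_def awalk_Nil_iff)
    show "cmp (path_kcat K Q) b b b' f (idm (path_kcat K Q) b) = f"
      if "f \<in> carrier (homs (path_kcat K Q) b b')" for b b' f
      by (rule ext) (simp add: cmp_path_vec_right[OF cring_axioms rng[OF that]])
  next
    fix b b' b'' g g' f
    assume "g \<in> carrier (homs (path_kcat K Q) b' b'')" "g' \<in> carrier (homs (path_kcat K Q) b' b'')"
      "f \<in> carrier (homs (path_kcat K Q) b b')"
    note val = this[THEN val]
    show "cmp (path_kcat K Q) b b' b'' (g \<oplus>\<^bsub>homs (path_kcat K Q) b' b''\<^esub> g') f
      = cmp (path_kcat K Q) b b' b'' g f \<oplus>\<^bsub>homs (path_kcat K Q) b b''\<^esub> cmp (path_kcat K Q) b b' b'' g' f"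
      unfolding path_kcat_cmp path_kcat_sel by (intro ext fin) (simp_all add: val l_distr)
  next
    fix b b' b'' g f f'
    assume "g \<in> carrier (homs (path_kcat K Q) b' b'')" "f \<in> carrier (homs (path_kcat K Q) b b')"
      "f' \<in> carrier (homs (path_kcat K Q) b b')"
    note val = this[THEN val]
    show "cmp (path_kcat K Q) b b' b'' g (f \<oplus>\<^bsub>homs (path_kcat K Q) b b'\<^esub> f')
      = cmp (path_kcat K Q) b b' b'' g f \<oplus>\<^bsub>homs (path_kcat K Q) b b''\<^esub> cmp (path_kcat K Q) b b' b'' g f'"
      unfolding path_kcat_cmp path_kcat_sel by (intro ext fin) (simp_all add: val r_distr)
  next
    fix b b' b'' c g f
    assume c: "c \<in> carrier K"
    assume "g \<in> carrier (homs (path_kcat K Q) b' b'')" "f \<in> carrier (homs (path_kcat K Q) b b')"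
    note val = this[THEN val]
    have "c \<otimes> (\<Oplus>i\<in>{..length r}. g (drop i r) \<otimes> f (take i r))
        = (\<Oplus>i\<in>{..length r}. c \<otimes> (g (drop i r) \<otimes> f (take i r)))" for r
      using c val by (intro finsum_rdistr) auto
    then show "cmp (path_kcat K Q) b b' b'' (c \<odot>\<^bsub>homs (path_kcat K Q) b' b''\<^esub> g) f
        = c \<odot>\<^bsub>homs (path_kcat K Q) b b''\<^esub> cmp (path_kcat K Q) b b' b'' g f"
      and "cmp (path_kcat K Q) b b' b'' g (c \<odot>\<^bsub>homs (path_kcat K Q) b b'\<^esub> f)
        = c \<odot>\<^bsub>homs (path_kcat K Q) b b''\<^esub> cmp (path_kcat K Q) b b' b'' g f"
      using c val by (simp_all add: path_kcat_cmp m_ac)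
  qed (use path_kcat_homs_module[OF cring_axioms] path_kcat_cmp_closed[OF cring_axioms assms(2)]
      path_kcat_cmp_idm_left[OF cring_axioms rng] path_kcat_cmp_assoc[OF cring_axioms rng rng rng] in simp_all)
qed

section \<open>Quotients of linear categories\<close>

context k_category
begin

lemma hom_abelian_group: "b \<in> objs B \<Longrightarrow> b' \<in> objs B \<Longrightarrow> abelian_group (homs B b b')"
  using homs_module by (rule module.axioms(2))

lemma cmp_zero_right [simp]:
  assumes "b \<in> objs B" "b' \<in> objs B" "b'' \<in> objs B" "g \<in> carrier (homs B b' b'')"
  shows "cmp B b b' b'' g \<zero>\<^bsub>homs B b b'\<^esub> = \<zero>\<^bsub>homs B b b''\<^esub>"
proof -
  interpret M: Module.module K "homs B b b'" by (rule homs_module) fact+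
  interpret N: Module.module K "homs B b b''" by (rule homs_module) fact+
  have "cmp B b b' b'' g (\<zero> \<odot>\<^bsub>homs B b b'\<^esub> \<zero>\<^bsub>homs B b b'\<^esub>)
    = \<zero> \<odot>\<^bsub>homs B b b''\<^esub> cmp B b b' b'' g \<zero>\<^bsub>homs B b b'\<^esub>"
    by (rule cmp_smult_right) (use assms in auto)
  then show ?thesis
    using assms by (simp add: cmp_closed)
qed

lemma cmp_zero_left [simp]:
  assumes "b \<in> objs B" "b' \<in> objs B" "b'' \<in> objs B" "f \<in> carrier (homs B b b')"
  shows "cmp B b b' b'' \<zero>\<^bsub>homs B b' b''\<^esub> f = \<zero>\<^bsub>homs B b b''\<^esub>"
proof -
  interpret M: Module.module K "homs B b' b''" by (rule homs_module) fact+
  interpret N: Module.module K "homs B b b''" by (rule homs_module) fact+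
  have "cmp B b b' b'' (\<zero> \<odot>\<^bsub>homs B b' b''\<^esub> \<zero>\<^bsub>homs B b' b''\<^esub>) f
    = \<zero> \<odot>\<^bsub>homs B b b''\<^esub> cmp B b b' b'' \<zero>\<^bsub>homs B b' b''\<^esub> f"
    by (rule cmp_smult_left) (use assms in auto)
  then show ?thesis
    using assms by (simp add: cmp_closed)
qed

end

text \<open>
  The ideal \<open>I\<close> is kept as a family of subspaces of the morphism spaces, which is the form that
  \<^const>\<open>quotient_kcat\<close> expects.
\<close>

locale two_sided_ideal = k_category K B
  for K :: "('k, 'c) ring_scheme" (structure) and B :: "('k, 'o, 'm) kcat" +
  fixes I :: "'o \<Rightarrow> 'o \<Rightarrow> 'm set"
  assumes I_submodule: "\<lbrakk>b \<in> objs B; b' \<in> objs B\<rbrakk> \<Longrightarrow> submodule (I b b') K (homs B b b')"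
    and I_cmp_left:
      "\<lbrakk>b \<in> objs B; b' \<in> objs B; b'' \<in> objs B; g \<in> carrier (homs B b' b''); f \<in> I b b'\<rbrakk>
       \<Longrightarrow> cmp B b b' b'' g f \<in> I b b''"
    and I_cmp_right:
      "\<lbrakk>b \<in> objs B; b' \<in> objs B; b'' \<in> objs B; g \<in> I b' b''; f \<in> carrier (homs B b b')\<rbrakk>
       \<Longrightarrow> cmp B b b' b'' g f \<in> I b b''"
begin

abbreviation quot :: "('k, 'o, 'm set) kcat" where
  "quot \<equiv> quotient_kcat B I"

definition cls :: "'o \<Rightarrow> 'o \<Rightarrow> 'm \<Rightarrow> 'm set" where
  "cls b b' f = I b b' +>\<^bsub>homs B b b'\<^esub> f"

lemma quot_objs [simp]: "objs quot = objs B"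
  by (simp add: quotient_kcat_def)

lemma quot_carrier:
  "carrier (homs quot b b') = cls b b' ` carrier (homs B b b')"
  by (auto simp: quotient_kcat_def A_RCOSETS_def' cls_def)

lemma quot_zero: "\<zero>\<^bsub>homs quot b b'\<^esub> = I b b'"
  by (simp add: quotient_kcat_def)

lemma quot_idm: "idm quot b = cls b b (idm B b)"
  by (simp add: quotient_kcat_def cls_def)

context
  fixes b b'
  assumes b: "b \<in> objs B" and b': "b' \<in> objs B"
begin

interpretation M: Module.module K "homs B b b'"
  using b b' by (rule homs_module)

lemma I_subset: "I b b' \<subseteq> carrier (homs B b b')"
  using M.submoduleE(1)[OF I_submodule[OF b b']] .

lemma I_subgroup: "subgroup (I b b') (add_monoid (homs B b b'))"
  using I_submodule[OF b b'] by (rule submodule.axioms)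

lemma cls_self: "f \<in> carrier (homs B b b') \<Longrightarrow> f \<in> cls b b' f"
  unfolding cls_def
  using abelian_subgroup.a_rcos_self[OF abelian_subgroupI3[OF additive_subgroupI[OF I_subgroup] M.abelian_group_axioms]] .

lemma cls_absorb:
  assumes "i \<in> I b b'" "f \<in> carrier (homs B b b')"
  shows "cls b b' (i \<oplus>\<^bsub>homs B b b'\<^esub> f) = cls b b' f"
  unfolding cls_def
  by (rule M.a_repr_independence[symmetric])
    (use assms I_subset I_subgroup in \<open>auto intro: M.a_rcosI\<close>)

lemma cls_memE:
  assumes "f' \<in> cls b b' f"
  obtains i where "i \<in> I b b'" "f' = i \<oplus>\<^bsub>homs B b b'\<^esub> f"
  using assms unfolding cls_def a_r_coset_def' by blast

lemma cls_eq_zero_iff: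
  "f \<in> carrier (homs B b b') \<Longrightarrow> cls b b' f = \<zero>\<^bsub>homs quot b b'\<^esub> \<longleftrightarrow> f \<in> I b b'"
  unfolding quot_zero cls_def
  using M.a_coset_join1 M.a_coset_join2 I_subgroup by blast

lemma cls_add:
  assumes "f \<in> carrier (homs B b b')" "g \<in> carrier (homs B b b')"
  shows "cls b b' f \<oplus>\<^bsub>homs quot b b'\<^esub> cls b b' g = cls b b' (f \<oplus>\<^bsub>homs B b b'\<^esub> g)"
  using abelian_subgroup.a_rcos_sum[OF abelian_subgroupI3[OF additive_subgroupI[OF I_subgroup] M.abelian_group_axioms] assms]
  by (simp add: quotient_kcat_def cls_def)

text \<open>
  In the quotient, scalar multiplication is the union of the cosets of the multiples of all
  representatives. These cosets agree because the ideal is stable under scalars, and the union is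
  not empty, so it is a single coset. The same reasoning gives the composition in \<open>cls_cmp\<close> below.
\<close>

lemma cls_smult:
  assumes c: "c \<in> carrier K" and f: "f \<in> carrier (homs B b b')"
  shows "c \<odot>\<^bsub>homs quot b b'\<^esub> cls b b' f = cls b b' (c \<odot>\<^bsub>homs B b b'\<^esub> f)"
proof -
  have "cls b b' (c \<odot>\<^bsub>homs B b b'\<^esub> f') = cls b b' (c \<odot>\<^bsub>homs B b b'\<^esub> f)" if f': "f' \<in> cls b b' f" for f'
  proof -
    obtain i where i: "i \<in> I b b'" and f': "f' = i \<oplus>\<^bsub>homs B b b'\<^esub> f"
      using f' by (rule cls_memE)
    have "c \<odot>\<^bsub>homs B b b'\<^esub> i \<in> I b b'"
      using I_submodule[OF b b'] c i by (rule submodule.smult_closed)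
    then show ?thesis
      unfolding f' using i c f I_subset by (simp add: M.smult_r_distr cls_absorb subset_iff)
  qed
  then have "(\<Union>f'\<in>cls b b' f. cls b b' (c \<odot>\<^bsub>homs B b b'\<^esub> f')) = cls b b' (c \<odot>\<^bsub>homs B b b'\<^esub> f)"
    using cls_self[OF f] by blast
  then show ?thesis
    by (simp add: quotient_kcat_def cls_def)
qed

lemma quot_homs_module: "Module.module K (homs quot b b')"
proof -
  let ?N = "homs quot b b'"
  have zero: "\<zero>\<^bsub>?N\<^esub> = cls b b' \<zero>\<^bsub>homs B b b'\<^esub>"
    using cls_eq_zero_iff[OF M.zero_closed] subgroup.one_closed[OF I_subgroup] by simp
  have ab: "abelian_group ?N"
  proof (rule abelian_groupI)
    show "\<exists>G\<in>carrier ?N. G \<oplus>\<^bsub>?N\<^esub> F = \<zero>\<^bsub>?N\<^esub>" if F: "F \<in> carrier ?N" for F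
    proof -
      from F obtain f where f: "f \<in> carrier (homs B b b')" "F = cls b b' f"
        by (auto simp: quot_carrier)
      then show ?thesis
        unfolding quot_carrier zero
        by (intro bexI[where x = "cls b b' (\<ominus>\<^bsub>homs B b b'\<^esub> f)"]) (auto simp: cls_add M.l_neg)
    qed
  qed (auto simp: quot_carrier zero cls_add M.a_ac)
  show ?thesis
    by (rule moduleI[OF cring_axioms ab])
      (auto simp: quot_carrier cls_add cls_smult M.smult_l_distr M.smult_r_distr M.smult_assoc1)
qed

end

lemma cls_cmp:
  assumes obj: "b \<in> objs B" "b' \<in> objs B" "b'' \<in> objs B"
    and g: "g \<in> carrier (homs B b' b'')" and f: "f \<in> carrier (homs B b b')"
  shows "cmp quot b b' b'' (cls b' b'' g) (cls b b' f) = cls b b'' (cmp B b b' b'' g f)"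
proof -
  interpret M: Module.module K "homs B b b''"
    using obj(1,3) by (rule homs_module)
  interpret M': Module.module K "homs B b b'"
    using obj(1,2) by (rule homs_module)
  have "cls b b'' (cmp B b b' b'' g' f') = cls b b'' (cmp B b b' b'' g f)"
    if g': "g' \<in> cls b' b'' g" and f': "f' \<in> cls b b' f" for g' f'
  proof -
    obtain j where j: "j \<in> I b' b''" and g': "g' = j \<oplus>\<^bsub>homs B b' b''\<^esub> g"
      using cls_memE[OF obj(2,3) g'] .
    obtain i where i: "i \<in> I b b'" and f': "f' = i \<oplus>\<^bsub>homs B b b'\<^esub> f"
      using cls_memE[OF obj(1,2) f'] .
    have i': "i \<in> carrier (homs B b b')" and j': "j \<in> carrier (homs B b' b'')"
      using i j I_subset obj by auto
    have f'_closed: "f' \<in> carrier (homs B b b')"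
      using i' f by (simp add: f')
    \<comment> \<open>Replacing \<open>g\<close> by \<open>j + g\<close> and \<open>f\<close> by \<open>i + f\<close> changes the composite by \<open>j f' + g i\<close>.\<close>
    have "cmp B b b' b'' g' f' = cmp B b b' b'' j f' \<oplus>\<^bsub>homs B b b''\<^esub>
        (cmp B b b' b'' g i \<oplus>\<^bsub>homs B b b''\<^esub> cmp B b b' b'' g f)"
      using obj g f i' j' f'_closed by (simp add: g' cmp_add_left) (simp add: f' cmp_add_right)
    moreover have "cmp B b b' b'' j f' \<in> I b b''" "cmp B b b' b'' g i \<in> I b b''"
      using obj i j g f'_closed by (auto intro: I_cmp_left I_cmp_right)
    ultimately show ?thesis
      using obj g f i' by (simp add: cls_absorb cmp_closed)
  qed
  then have "(\<Union>g'\<in>cls b' b'' g. \<Union>f'\<in>cls b b' f. cls b b'' (cmp B b b' b'' g' f'))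
      = (\<Union>g'\<in>cls b' b'' g. \<Union>f'\<in>cls b b' f. cls b b'' (cmp B b b' b'' g f))"
    by simp
  also have "\<dots> = cls b b'' (cmp B b b' b'' g f)"
    using cls_self[OF obj(2,3) g] cls_self[OF obj(1,2) f] by auto
  finally show ?thesis
    by (simp add: quotient_kcat_def cls_def)
qed

text \<open>
  Passing to classes respects all operations and is onto on morphisms, so every axiom is inherited.
\<close>

lemma k_category_quot: "k_category K quot"
proof (intro k_category.intro field_axioms k_category_axioms.intro)
  show "Module.module K (homs quot b b')" if "b \<in> objs quot" "b' \<in> objs quot" for b b'
    using that quot_homs_module by simp
  show "idm quot b \<in> carrier (homs quot b b)" if "b \<in> objs quot" for b
    using that idm_closed by (auto simp: quot_idm quot_carrier)
qed (auto simp: quot_carrier quot_idm cls_cmp cls_add cls_smult cmp_closed idm_closed cmp_idm_left cmp_idm_right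
    cmp_assoc cmp_add_left cmp_add_right cmp_smult_left cmp_smult_right
    homs_module[THEN module.smult_closed] hom_abelian_group[THEN abelian_group.axioms(1), THEN abelian_monoid.a_closed])

end

section \<open>Direct sums and lines in vector spaces\<close>

lemma ex1_unique: "\<exists>!x. P x \<Longrightarrow> P x \<Longrightarrow> P y \<Longrightarrow> x = y"
  by blast

lemma (in abelian_monoid) finsum_nonzero_support:
  assumes "finite F" "{s\<in>S. c s \<noteq> \<zero>} \<subseteq> F" "F \<subseteq> S" "c \<in> S \<rightarrow> carrier G"
  shows "(\<Oplus>s\<in>{s\<in>S. c s \<noteq> \<zero>}. c s) = (\<Oplus>s\<in>F. c s)"
  using assms by (intro add.finprod_mono_neutral_cong_left) auto

lemma direct_sum_submodule: "is_direct_sum K M S V \<Longrightarrow> s \<in> S \<Longrightarrow> submodule (V s) K M"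
  by (simp add: is_direct_sum_def)

text \<open>
  Scalars from a field are what allows a line to be recovered from any of its non-zero vectors.
\<close>

locale linear_space = Module.module K M + field K
  for K :: "('k, 'c) ring_scheme" (structure) and M :: "('k, 'm) module" (structure)
begin

lemma submodule_closed: "submodule H K M \<Longrightarrow> x \<in> H \<Longrightarrow> x \<in> carrier M"
  using submoduleE(1) by blast

lemma submodule_zero: "submodule H K M \<Longrightarrow> \<zero>\<^bsub>M\<^esub> \<in> H"
  using subgroup.one_closed[OF submodule.axioms(1)] by fastforce

text \<open>
  Decompositions are normally indexed by their supports. Here two decompositions may be summed over
  any finite index sets that contain the supports, so that they can be compared without computing the
  supports.
\<close>

lemma direct_sum_unique:
  assumes sum: "is_direct_sum K M S V"
    and c: "c \<in> (\<Pi>\<^sub>E s\<in>S. V s)" "finite F" "F \<subseteq> S" "\<And>s. s \<in> S - F \<Longrightarrow> c s = \<zero>\<^bsub>M\<^esub>"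
    and d: "d \<in> (\<Pi>\<^sub>E s\<in>S. V s)" "finite G" "G \<subseteq> S" "\<And>s. s \<in> S - G \<Longrightarrow> d s = \<zero>\<^bsub>M\<^esub>"
    and eq: "(\<Oplus>\<^bsub>M\<^esub>s\<in>F. c s) = (\<Oplus>\<^bsub>M\<^esub>s\<in>G. d s)"
  shows "c = d"
proof -
  have closed: "e \<in> S \<rightarrow> carrier M" if "e \<in> (\<Pi>\<^sub>E s\<in>S. V s)" for e
    using that sum submodule_closed unfolding is_direct_sum_def by fast
  have supp: "finite {s\<in>S. e s \<noteq> \<zero>\<^bsub>M\<^esub>}"
      "(\<Oplus>\<^bsub>M\<^esub>s\<in>{s\<in>S. e s \<noteq> \<zero>\<^bsub>M\<^esub>}. e s) = (\<Oplus>\<^bsub>M\<^esub>s\<in>H. e s)"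
    if e: "e \<in> (\<Pi>\<^sub>E s\<in>S. V s)" "finite H" "H \<subseteq> S" "\<And>s. s \<in> S - H \<Longrightarrow> e s = \<zero>\<^bsub>M\<^esub>" for e H
  proof -
    have "{s\<in>S. e s \<noteq> \<zero>\<^bsub>M\<^esub>} \<subseteq> H" using e(4) by blast
    then show "finite {s\<in>S. e s \<noteq> \<zero>\<^bsub>M\<^esub>}"
      "(\<Oplus>\<^bsub>M\<^esub>s\<in>{s\<in>S. e s \<noteq> \<zero>\<^bsub>M\<^esub>}. e s) = (\<Oplus>\<^bsub>M\<^esub>s\<in>H. e s)"
      using e(2) M.finsum_nonzero_support[OF e(2) _ e(3) closed[OF e(1)]] by (simp_all add: finite_subset)
  qed
  have "(\<Oplus>\<^bsub>M\<^esub>s\<in>F. c s) \<in> carrier M"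
    using closed[OF c(1)] c(3) by (intro M.finsum_closed) blast
  then have ex: "\<exists>!e. e \<in> (\<Pi>\<^sub>E s\<in>S. V s) \<and> finite {s\<in>S. e s \<noteq> \<zero>\<^bsub>M\<^esub>} \<and>
      (\<Oplus>\<^bsub>M\<^esub>s\<in>F. c s) = (\<Oplus>\<^bsub>M\<^esub>s\<in>{s\<in>S. e s \<noteq> \<zero>\<^bsub>M\<^esub>}. e s)" (is "\<exists>!e. ?P e")
    using sum unfolding is_direct_sum_def by blast
  have "?P c" "?P d"
    using c(1) d(1) eq supp[OF c] supp[OF d] by simp_all
  then show "c = d"
    by (rule ex1_unique[OF ex])
qed

text \<open>
  A sum of two components in different pieces can only be homogeneous if one of them vanishes. This
  determines all homogeneous elements of a space that is the sum of two pieces.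
\<close>

lemma direct_sum_pair_unique:
  assumes sum: "is_direct_sum K M S V"
    and S: "s \<in> S" "t \<in> S" "r \<in> S" "s \<noteq> t"
    and V: "u \<in> V s" "v \<in> V t" "u \<oplus>\<^bsub>M\<^esub> v \<in> V r"
  shows "(u = \<zero>\<^bsub>M\<^esub> \<or> r = s) \<and> (v = \<zero>\<^bsub>M\<^esub> \<or> r = t)"
proof -
  let ?c = "\<lambda>x\<in>S. if x = s then u else if x = t then v else \<zero>\<^bsub>M\<^esub>"
  let ?d = "\<lambda>x\<in>S. if x = r then u \<oplus>\<^bsub>M\<^esub> v else \<zero>\<^bsub>M\<^esub>"
  note sub = direct_sum_submodule[OF sum]
  have closed: "u \<in> carrier M" "v \<in> carrier M"
    using V S sub submodule_closed by blast+
  \<comment> \<open>Both families decompose \<open>u + v\<close>: one into its two summands, one as a single homogeneous element.\<close>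
  have "?c = ?d"
  proof (rule direct_sum_unique[OF sum])
    show "(\<Oplus>\<^bsub>M\<^esub>s\<in>{s, t}. ?c s) = (\<Oplus>\<^bsub>M\<^esub>s\<in>{r}. ?d s)"
      using S closed by simp
  qed (use S V submodule_zero[OF sub] in auto)
  from fun_cong[OF this, of s] fun_cong[OF this, of t] S show ?thesis
    by (auto split: if_splits)
qed

lemma direct_sum_disjoint:
  assumes sum: "is_direct_sum K M S V" and S: "s \<in> S" "t \<in> S" "s \<noteq> t"
    and f: "f \<in> V s" "f \<in> V t"
  shows "f = \<zero>\<^bsub>M\<^esub>"
proof -
  note sub = direct_sum_submodule[OF sum]
  have "f \<in> carrier M" using f(1) S(1) sub submodule_closed by blast
  then show ?thesis
    using direct_sum_pair_unique[OF sum S(1,2,2,3) f(1) submodule_zero[OF sub[OF S(2)]]] f(2) S(3) by simp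
qed

text \<open>
  The last property of the components \<open>c\<close> is the only trace of their sum that is used: if at most one
  of them is non-zero, then that one is \<open>f\<close>.
\<close>

lemma direct_sum_component:
  assumes sum: "is_direct_sum K M S V" and f: "f \<in> carrier M"
  obtains c where "\<And>s. s \<in> S \<Longrightarrow> c s \<in> V s" "f \<noteq> \<zero>\<^bsub>M\<^esub> \<longrightarrow> (\<exists>s\<in>S. c s \<noteq> \<zero>\<^bsub>M\<^esub>)"
    "\<And>r. r \<in> S \<Longrightarrow> (\<And>s. s \<in> S \<Longrightarrow> s \<noteq> r \<Longrightarrow> c s = \<zero>\<^bsub>M\<^esub>) \<Longrightarrow> f = c r"
proof -
  obtain c where c: "c \<in> (\<Pi>\<^sub>E s\<in>S. V s)"
    and f: "f = (\<Oplus>\<^bsub>M\<^esub>s\<in>{s\<in>S. c s \<noteq> \<zero>\<^bsub>M\<^esub>}. c s)"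
    using sum f unfolding is_direct_sum_def by metis
  have closed: "c s \<in> carrier M" if "s \<in> S" for s
    using that c submodule_closed[OF direct_sum_submodule[OF sum]] by blast
  show thesis
  proof (rule that)
    show "c s \<in> V s" if "s \<in> S" for s using c that by blast
    show "f \<noteq> \<zero>\<^bsub>M\<^esub> \<longrightarrow> (\<exists>s\<in>S. c s \<noteq> \<zero>\<^bsub>M\<^esub>)"
      unfolding f by (auto dest: M.finsum_nonzeroD)
    show "f = c r" if "r \<in> S" "\<And>s. s \<in> S \<Longrightarrow> s \<noteq> r \<Longrightarrow> c s = \<zero>\<^bsub>M\<^esub>" for r
    proof -
      have "f = (\<Oplus>\<^bsub>M\<^esub>s\<in>{r}. c s)"
        unfolding f using that closed by (intro M.finsum_nonzero_support) auto
      then show ?thesis using closed that(1) by simp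
    qed
  qed
qed

text \<open>
  Gradings are indexed by all group elements; this turns a decomposition into two subspaces into a
  direct sum over the whole index set.
\<close>

lemma is_direct_sum_pair:
  assumes S: "s \<in> S" "t \<in> S" "s \<noteq> t"
    and sub: "submodule H K M" "submodule H' K M"
    and disjoint: "H \<inter> H' \<subseteq> {\<zero>\<^bsub>M\<^esub>}"
    and decomp: "\<And>f. f \<in> carrier M \<Longrightarrow> \<exists>u\<in>H. \<exists>v\<in>H'. f = u \<oplus>\<^bsub>M\<^esub> v"
  shows "is_direct_sum K M S (\<lambda>r. if r = s then H else if r = t then H' else {\<zero>\<^bsub>M\<^esub>})"
    (is "is_direct_sum K M S ?V")
proof -
  have "submodule {\<zero>\<^bsub>M\<^esub>} K M"
    by (rule submoduleI) auto
  with sub have Vsub: "submodule (?V r) K M" for r by simp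
  have supp: "finite {r\<in>S. c r \<noteq> \<zero>\<^bsub>M\<^esub>}"
      "(\<Oplus>\<^bsub>M\<^esub>r\<in>{r\<in>S. c r \<noteq> \<zero>\<^bsub>M\<^esub>}. c r) = c s \<oplus>\<^bsub>M\<^esub> c t" if c: "c \<in> (\<Pi>\<^sub>E r\<in>S. ?V r)" for c
  proof -
    have closed: "c r \<in> carrier M" if "r \<in> S" for r
      using that c submodule_closed[OF Vsub] by (blast dest: PiE_mem)
    have "c r = \<zero>\<^bsub>M\<^esub>" if "r \<in> S" "r \<noteq> s" "r \<noteq> t" for r
      using PiE_mem[OF c that(1)] that by simp
    then have "{r\<in>S. c r \<noteq> \<zero>\<^bsub>M\<^esub>} \<subseteq> {s, t}"
      by blast
    moreover from this have "(\<Oplus>\<^bsub>M\<^esub>r\<in>{r\<in>S. c r \<noteq> \<zero>\<^bsub>M\<^esub>}. c r) = (\<Oplus>\<^bsub>M\<^esub>r\<in>{s, t}. c r)"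
      using S closed by (intro M.finsum_nonzero_support) auto
    ultimately show "finite {r\<in>S. c r \<noteq> \<zero>\<^bsub>M\<^esub>}"
      "(\<Oplus>\<^bsub>M\<^esub>r\<in>{r\<in>S. c r \<noteq> \<zero>\<^bsub>M\<^esub>}. c r) = c s \<oplus>\<^bsub>M\<^esub> c t"
      using S closed by (auto intro: finite_subset)
  qed
  have "\<exists>!c. c \<in> (\<Pi>\<^sub>E r\<in>S. ?V r) \<and> finite {r\<in>S. c r \<noteq> \<zero>\<^bsub>M\<^esub>} \<and>
      f = (\<Oplus>\<^bsub>M\<^esub>r\<in>{r\<in>S. c r \<noteq> \<zero>\<^bsub>M\<^esub>}. c r)" if f: "f \<in> carrier M" for f
  proof (rule ex_ex1I)
    obtain u v where uv: "u \<in> H" "v \<in> H'" "f = u \<oplus>\<^bsub>M\<^esub> v" using decomp[OF f] by blast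
    let ?c = "\<lambda>r\<in>S. if r = s then u else if r = t then v else \<zero>\<^bsub>M\<^esub>"
    have "?c \<in> (\<Pi>\<^sub>E r\<in>S. ?V r)" using uv by auto
    from this supp[OF this] show "\<exists>c. c \<in> (\<Pi>\<^sub>E r\<in>S. ?V r) \<and> finite {r\<in>S. c r \<noteq> \<zero>\<^bsub>M\<^esub>} \<and>
      f = (\<Oplus>\<^bsub>M\<^esub>r\<in>{r\<in>S. c r \<noteq> \<zero>\<^bsub>M\<^esub>}. c r)"
      using S uv(3) by (intro exI[of _ ?c]) simp
  next
    fix c d
    assume "c \<in> (\<Pi>\<^sub>E r\<in>S. ?V r) \<and> finite {r\<in>S. c r \<noteq> \<zero>\<^bsub>M\<^esub>} \<and>
        f = (\<Oplus>\<^bsub>M\<^esub>r\<in>{r\<in>S. c r \<noteq> \<zero>\<^bsub>M\<^esub>}. c r)"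
      and "d \<in> (\<Pi>\<^sub>E r\<in>S. ?V r) \<and> finite {r\<in>S. d r \<noteq> \<zero>\<^bsub>M\<^esub>} \<and>
        f = (\<Oplus>\<^bsub>M\<^esub>r\<in>{r\<in>S. d r \<noteq> \<zero>\<^bsub>M\<^esub>}. d r)"
    then have c: "c \<in> (\<Pi>\<^sub>E r\<in>S. ?V r)" and d: "d \<in> (\<Pi>\<^sub>E r\<in>S. ?V r)"
      and "f = (\<Oplus>\<^bsub>M\<^esub>r\<in>{r\<in>S. c r \<noteq> \<zero>\<^bsub>M\<^esub>}. c r)" "f = (\<Oplus>\<^bsub>M\<^esub>r\<in>{r\<in>S. d r \<noteq> \<zero>\<^bsub>M\<^esub>}. d r)"
      by simp_all
    then have eq: "c s \<oplus>\<^bsub>M\<^esub> c t = d s \<oplus>\<^bsub>M\<^esub> d t"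
      using supp(2)[OF c] supp(2)[OF d] by simp
    have H: "c s \<in> H" "d s \<in> H" "c t \<in> H'" "d t \<in> H'"
      using PiE_mem[OF c S(1)] PiE_mem[OF d S(1)] PiE_mem[OF c S(2)] PiE_mem[OF d S(2)] S(3) by auto
    note closed = H(1,2)[THEN submodule_closed[OF sub(1)]] H(3,4)[THEN submodule_closed[OF sub(2)]]
    \<comment> \<open>Two decompositions of \<open>f\<close> differ by a vector in both subspaces.\<close>
    have shift: "c s \<ominus>\<^bsub>M\<^esub> d s = d t \<ominus>\<^bsub>M\<^esub> c t"
    proof -
      have "c s \<ominus>\<^bsub>M\<^esub> d s = (c s \<oplus>\<^bsub>M\<^esub> c t) \<ominus>\<^bsub>M\<^esub> c t \<ominus>\<^bsub>M\<^esub> d s"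
        using closed by (simp add: M.minus_eq M.a_assoc M.r_neg)
      also have "\<dots> = d t \<ominus>\<^bsub>M\<^esub> c t"
      proof -
        have "d s \<oplus>\<^bsub>M\<^esub> d t \<ominus>\<^bsub>M\<^esub> c t \<ominus>\<^bsub>M\<^esub> d s = (d s \<ominus>\<^bsub>M\<^esub> d s) \<oplus>\<^bsub>M\<^esub> (d t \<ominus>\<^bsub>M\<^esub> c t)"
          using closed by (simp add: M.minus_eq M.a_ac)
        then show ?thesis
          unfolding eq using closed by (simp add: M.minus_eq M.r_neg)
      qed
      finally show ?thesis .
    qed
    have "c s \<ominus>\<^bsub>M\<^esub> d s \<in> H" "d t \<ominus>\<^bsub>M\<^esub> c t \<in> H'"
      using H submoduleE(3,5)[OF sub(1)] submoduleE(3,5)[OF sub(2)] by (simp_all add: M.minus_eq)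
    with shift disjoint have zero: "c s \<ominus>\<^bsub>M\<^esub> d s = \<zero>\<^bsub>M\<^esub>" "d t \<ominus>\<^bsub>M\<^esub> c t = \<zero>\<^bsub>M\<^esub>" by auto
    have "c s = d s" "c t = d t"
      using zero closed by (metis M.add.inv_equality M.add.inv_inv M.add.inv_closed M.minus_eq)+
    moreover have "c r = d r" if "r \<in> S" "r \<noteq> s" "r \<noteq> t" for r
      using PiE_mem[OF c that(1)] PiE_mem[OF d that(1)] that by simp
    ultimately show "c = d"
      by (intro PiE_ext[OF c d]) blast
  qed
  with Vsub show ?thesis
    unfolding is_direct_sum_def by blast
qed

definition line where
  "line e = {c \<odot>\<^bsub>M\<^esub> e | c. c \<in> carrier K}"

lemma line_submodule:
  assumes e: "e \<in> carrier M"
  shows "submodule (line e) K M"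
proof (rule submoduleI)
  have lineI: "c \<odot>\<^bsub>M\<^esub> e \<in> line e" if "c \<in> carrier K" for c
    using that by (auto simp: line_def)
  show "line e \<subseteq> carrier M" using e by (auto simp: line_def)
  show "\<zero>\<^bsub>M\<^esub> \<in> line e" using lineI[of \<zero>] e by simp
  fix a assume "a \<in> line e"
  then obtain c where c: "c \<in> carrier K" "a = c \<odot>\<^bsub>M\<^esub> e" by (auto simp: line_def)
  show "\<ominus>\<^bsub>M\<^esub> a \<in> line e"
    using lineI[of "\<ominus> c"] c e by (simp add: smult_l_minus)
  show "d \<odot>\<^bsub>M\<^esub> a \<in> line e" if "d \<in> carrier K" for d
    using lineI[of "d \<otimes> c"] c e that by (simp add: smult_assoc1)
  show "a \<oplus>\<^bsub>M\<^esub> b \<in> line e" if b: "b \<in> line e" for b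
  proof -
    obtain d where "d \<in> carrier K" "b = d \<odot>\<^bsub>M\<^esub> e" using b by (auto simp: line_def)
    then show ?thesis using lineI[of "c \<oplus> d"] c e by (simp add: smult_l_distr)
  qed
qed

lemma line_self: "e \<in> carrier M \<Longrightarrow> e \<in> line e"
  using smult_one[of e] by (force simp: line_def)

lemma line_subset_submodule: "submodule H K M \<Longrightarrow> e \<in> H \<Longrightarrow> line e \<subseteq> H"
  unfolding line_def using submodule.smult_closed by fast

lemma smult_cancel:
  assumes "c \<in> carrier K" "c \<noteq> \<zero>" "e \<in> carrier M"
  shows "inv c \<odot>\<^bsub>M\<^esub> (c \<odot>\<^bsub>M\<^esub> e) = e"
proof -
  have "c \<in> Units K" using assms field_Units by blast
  then show ?thesis
    using assms by (simp flip: smult_assoc1)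
qed

lemma smult_eq_zeroD:
  assumes "c \<in> carrier K" "e \<in> carrier M" "c \<odot>\<^bsub>M\<^esub> e = \<zero>\<^bsub>M\<^esub>" "e \<noteq> \<zero>\<^bsub>M\<^esub>"
  shows "c = \<zero>"
proof (rule ccontr)
  assume "c \<noteq> \<zero>"
  then have "c \<in> Units K" using assms field_Units by blast
  then show False
    using smult_cancel[OF assms(1) \<open>c \<noteq> \<zero>\<close> assms(2)] assms(3,4) by simp
qed

text \<open>
  The coefficient of the non-zero vector \<open>f\<close> can be divided out.
\<close>

lemma generator_in_submodule:
  assumes "submodule H K M" "e \<in> carrier M" "f \<in> line e" "f \<noteq> \<zero>\<^bsub>M\<^esub>" "f \<in> H"
  shows "e \<in> H"
proof -
  obtain c where c: "c \<in> carrier K" "f = c \<odot>\<^bsub>M\<^esub> e" using assms(3) by (auto simp: line_def)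
  then have "c \<noteq> \<zero>" using assms(2,4) by auto
  moreover from this have "inv c \<in> carrier K"
    using c(1) field_Units by (metis DiffI Units_inv_closed singletonD)
  ultimately show ?thesis
    using smult_cancel[OF c(1) _ assms(2)] submodule.smult_closed[OF assms(1) _ assms(5)] c(2) by metis
qed

text \<open>
  A one-dimensional space lies in a single piece of any direct sum decomposition: some component
  of the generator is non-zero, and it is a multiple of the generator.
\<close>

lemma direct_sum_line_homogeneous:
  assumes "is_direct_sum K M S V" "S \<noteq> {}" "e \<in> carrier M" "carrier M = line e"
  obtains s where "s \<in> S" "e \<in> V s"
proof (cases "e = \<zero>\<^bsub>M\<^esub>")
  case True
  then show thesis
    using assms(2) that submodule_zero[OF direct_sum_submodule[OF assms(1)]] by blast
next
  case False
  obtain c where "\<And>s. s \<in> S \<Longrightarrow> c s \<in> V s" "e \<noteq> \<zero>\<^bsub>M\<^esub> \<longrightarrow> (\<exists>s\<in>S. c s \<noteq> \<zero>\<^bsub>M\<^esub>)"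
    using direct_sum_component[OF assms(1,3)] by metis
  with False obtain s where s: "s \<in> S" "c s \<in> V s" "c s \<noteq> \<zero>\<^bsub>M\<^esub>" by blast
  note sub = direct_sum_submodule[OF assms(1) s(1)]
  have "c s \<in> line e" using submodule_closed[OF sub s(2)] assms(4) by simp
  from generator_in_submodule[OF sub assms(3) this s(3,2)] s(1) show thesis by (rule that[rotated])
qed

end

section \<open>A triangle with a tail, and its two-part decomposition\<close>

lemma (in k_category) hom_space:
  "b \<in> objs B \<Longrightarrow> b' \<in> objs B \<Longrightarrow> linear_space K (homs B b b')"
  by (intro linear_space.intro homs_module field_axioms)

abbreviation (in k_category) hom_line :: "'o \<Rightarrow> 'o \<Rightarrow> 'm \<Rightarrow> 'm set" where
  "hom_line b b' \<equiv> linear_space.line K (homs B b b')"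

text \<open>
  A description of \<open>\<B>\<^sub>q\<close> up to isomorphism in which \<open>q\<close> does not occur. The generators \<open>al\<close>, \<open>be\<close> and \<open>de\<close>
  stand for the classes of \<open>\<alpha>\<close>, \<open>\<beta>\<close> and \<open>\<delta>\<close>, while \<open>ga\<close> stands for the class of \<open>\<gamma> - q\<beta>\<alpha>\<close>, not of
  \<open>\<gamma>\<close>: the relation of \<open>\<B>\<^sub>q\<close> says that \<open>\<delta>(\<gamma> - q\<beta>\<alpha>) = 0\<close>. Apart from the plane from
  \<open>x\<close> to \<open>z\<close>, each morphism space is zero or spanned by one composite of generators, which is an identity
  in the case of loops.
\<close>

locale triangle_with_tail = k_category K B
  for K :: "('k, 'c) ring_scheme" (structure) and B :: "('k, vertex, 'm) kcat" +
  fixes al be ga de :: 'm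
  assumes objs_eq [simp]: "objs B = UNIV"
    and al_closed: "al \<in> carrier (homs B Vx Vy)"
    and be_closed: "be \<in> carrier (homs B Vy Vz)"
    and ga_closed: "ga \<in> carrier (homs B Vx Vz)"
    and de_closed: "de \<in> carrier (homs B Vz Vz')"
    and hom_loop: "carrier (homs B v v) = hom_line v v (idm B v)"
    and hom_xy: "carrier (homs B Vx Vy) = hom_line Vx Vy al"
    and hom_yz: "carrier (homs B Vy Vz) = hom_line Vy Vz be"
    and hom_zz': "carrier (homs B Vz Vz') = hom_line Vz Vz' de"
    and hom_yz': "carrier (homs B Vy Vz') = hom_line Vy Vz' (cmp B Vy Vz Vz' de be)"
    and hom_xz': "carrier (homs B Vx Vz')
      = hom_line Vx Vz' (cmp B Vx Vz Vz' de (cmp B Vx Vy Vz be al))"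
    and hom_xz: "f \<in> carrier (homs B Vx Vz) \<Longrightarrow> \<exists>c\<in>carrier K. \<exists>d\<in>carrier K.
      f = c \<odot>\<^bsub>homs B Vx Vz\<^esub> cmp B Vx Vy Vz be al \<oplus>\<^bsub>homs B Vx Vz\<^esub> d \<odot>\<^bsub>homs B Vx Vz\<^esub> ga"
    and hom_trivial:
      "(b, b') \<in> {(Vy, Vx), (Vz, Vx), (Vz', Vx), (Vz, Vy), (Vz', Vy), (Vz', Vz)}
       \<Longrightarrow> carrier (homs B b b') = {\<zero>\<^bsub>homs B b b'\<^esub>}"
    and ga_nonzero: "ga \<noteq> \<zero>\<^bsub>homs B Vx Vz\<^esub>"
    and de_ga: "cmp B Vx Vz Vz' de ga = \<zero>\<^bsub>homs B Vx Vz'\<^esub>"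
    and path_nonzero: "cmp B Vx Vz Vz' de (cmp B Vx Vy Vz be al) \<noteq> \<zero>\<^bsub>homs B Vx Vz'\<^esub>"
begin

abbreviation ba :: 'm where "ba \<equiv> cmp B Vx Vy Vz be al"
abbreviation db :: 'm where "db \<equiv> cmp B Vy Vz Vz' de be"
abbreviation dba :: 'm where "dba \<equiv> cmp B Vx Vz Vz' de ba"

lemma linear_space_homs: "linear_space K (homs B b b')"
  by (rule hom_space) simp_all

lemma module_homs: "Module.module K (homs B b b')"
  by (rule homs_module) simp_all

lemmas smult_closed [simp, intro] = module.smult_closed[OF module_homs]
lemmas smult_zero [simp] = module.smult_r_null[OF module_homs]
lemmas abelian_monoid_homs = module_homs[THEN module.axioms(2), THEN abelian_group.axioms(1)]
lemmas zero_closed [simp, intro] = abelian_monoid.zero_closed[OF abelian_monoid_homs]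
lemmas add_closed [simp, intro] = abelian_monoid.a_closed[OF abelian_monoid_homs]
lemmas add_zero_left [simp] = abelian_monoid.l_zero[OF abelian_monoid_homs]
lemmas add_zero_right [simp] = abelian_monoid.r_zero[OF abelian_monoid_homs]
lemmas cmp_closed' [simp, intro] = cmp_closed[simplified]
lemmas hom_line_def = linear_space.line_def[OF linear_space_homs]
lemmas smult_eq_zeroD = linear_space.smult_eq_zeroD[OF linear_space_homs]

lemma ba_closed: "ba \<in> carrier (homs B Vx Vz)"
  using al_closed be_closed by blast

lemma generators_nonzero:
  "al \<noteq> \<zero>\<^bsub>homs B Vx Vy\<^esub>" "be \<noteq> \<zero>\<^bsub>homs B Vy Vz\<^esub>" "de \<noteq> \<zero>\<^bsub>homs B Vz Vz'\<^esub>"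
  using path_nonzero al_closed be_closed de_closed by auto

lemma cmp_de:
  assumes "c \<in> carrier K" "d \<in> carrier K"
  shows "cmp B Vx Vz Vz' de (c \<odot>\<^bsub>homs B Vx Vz\<^esub> ba \<oplus>\<^bsub>homs B Vx Vz\<^esub> d \<odot>\<^bsub>homs B Vx Vz\<^esub> ga)
    = c \<odot>\<^bsub>homs B Vx Vz'\<^esub> dba"
  using assms de_closed ba_closed ga_closed by (simp add: cmp_add_right cmp_smult_right de_ga)

text \<open>
  The line through \<open>ga\<close> is singled out by the category alone, as the kernel of composition with \<open>de\<close>.
  Hence gradings and automorphisms have to respect it.
\<close>

lemma kernel_de:
  assumes f: "f \<in> carrier (homs B Vx Vz)" and zero: "cmp B Vx Vz Vz' de f = \<zero>\<^bsub>homs B Vx Vz'\<^esub>"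
  shows "f \<in> hom_line Vx Vz ga"
proof -
  obtain c d where cd: "c \<in> carrier K" "d \<in> carrier K"
    "f = c \<odot>\<^bsub>homs B Vx Vz\<^esub> ba \<oplus>\<^bsub>homs B Vx Vz\<^esub> d \<odot>\<^bsub>homs B Vx Vz\<^esub> ga"
    using hom_xz[OF f] by blast
  have "c = \<zero>"
    using cd zero cmp_de[of c d] de_closed ba_closed path_nonzero smult_eq_zeroD[of c dba] by auto
  then show ?thesis
    using cd ba_closed ga_closed module.smult_l_null[OF module_homs]
    by (auto simp: hom_line_def)
qed

text \<open>
  Every morphism space is the direct sum of \<open>base_part\<close>, spanned by identities and composites of
  \<open>al\<close>, \<open>be\<close>, \<open>de\<close>, and \<open>twist_part\<close>, spanned by \<open>ga\<close>. These are the pieces of degree \<open>1\<close> and \<open>t\<close> of the universal grading.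
\<close>

definition base_part :: "vertex \<Rightarrow> vertex \<Rightarrow> 'm set" where
  "base_part b b' = (if b = Vx \<and> b' = Vz then hom_line Vx Vz ba else carrier (homs B b b'))"

definition twist_part :: "vertex \<Rightarrow> vertex \<Rightarrow> 'm set" where
  "twist_part b b' = (if b = Vx \<and> b' = Vz then hom_line Vx Vz ga else {\<zero>\<^bsub>homs B b b'\<^esub>})"

lemma zero_submodule: "submodule {\<zero>\<^bsub>homs B b b'\<^esub>} K (homs B b b')"
proof -
  interpret linear_space K "homs B b b'" by (rule linear_space_homs)
  show ?thesis by (rule submoduleI) auto
qed

lemma base_part_submodule: "submodule (base_part b b') K (homs B b b')"
  using linear_space.line_submodule[OF linear_space_homs ba_closed]
    module.carrier_is_submodule[OF module_homs]
  by (simp add: base_part_def)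

lemma twist_part_submodule: "submodule (twist_part b b') K (homs B b b')"
  using linear_space.line_submodule[OF linear_space_homs ga_closed] zero_submodule
  by (simp add: twist_part_def)

lemma parts_closed:
  "f \<in> base_part b b' \<Longrightarrow> f \<in> carrier (homs B b b')"
  "f \<in> twist_part b b' \<Longrightarrow> f \<in> carrier (homs B b b')"
  using linear_space.submodule_closed[OF linear_space_homs base_part_submodule]
    linear_space.submodule_closed[OF linear_space_homs twist_part_submodule] by blast+

lemma parts_disjoint: "base_part b b' \<inter> twist_part b b' \<subseteq> {\<zero>\<^bsub>homs B b b'\<^esub>}"
proof (cases "b = Vx \<and> b' = Vz")
  case True
  have "f = \<zero>\<^bsub>homs B Vx Vz\<^esub>" if base: "f \<in> hom_line Vx Vz ba" and twist: "f \<in> hom_line Vx Vz ga" for f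
  proof -
    obtain c where c: "c \<in> carrier K" "f = c \<odot>\<^bsub>homs B Vx Vz\<^esub> ba"
      using base by (auto simp: hom_line_def)
    obtain d where d: "d \<in> carrier K" "f = d \<odot>\<^bsub>homs B Vx Vz\<^esub> ga"
      using twist by (auto simp: hom_line_def)
    have "c \<odot>\<^bsub>homs B Vx Vz'\<^esub> dba = cmp B Vx Vz Vz' de f"
      using c ba_closed de_closed by (simp add: cmp_smult_right)
    also have "\<dots> = \<zero>\<^bsub>homs B Vx Vz'\<^esub>"
      using d ga_closed de_closed by (simp add: cmp_smult_right de_ga)
    finally have "c = \<zero>"
      using c(1) ba_closed de_closed path_nonzero smult_eq_zeroD by blast
    then show ?thesis
      using c ba_closed module.smult_l_null[OF module_homs] by simp
  qed
  with True show ?thesis by (auto simp: base_part_def twist_part_def)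
qed (auto simp: base_part_def twist_part_def)

lemma parts_decompose:
  assumes f: "f \<in> carrier (homs B b b')"
  shows "\<exists>u\<in>base_part b b'. \<exists>v\<in>twist_part b b'. f = u \<oplus>\<^bsub>homs B b b'\<^esub> v"
proof (cases "b = Vx \<and> b' = Vz")
  case True
  with f hom_xz[of f] show ?thesis by (fastforce simp: base_part_def twist_part_def hom_line_def)
next
  case False
  with f show ?thesis by (auto simp: base_part_def twist_part_def)
qed

lemma smult_idm_cmp:
  assumes "f \<in> carrier (homs B b b')" "g \<in> carrier (homs B b' b')"
  obtains c where "c \<in> carrier K" "cmp B b b' b' g f = c \<odot>\<^bsub>homs B b b'\<^esub> f"
proof -
  obtain c where "c \<in> carrier K" "g = c \<odot>\<^bsub>homs B b' b'\<^esub> idm B b'"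
    using assms(2) hom_loop by (auto simp: hom_line_def)
  with assms(1) show thesis
    by (intro that[of c]) (simp_all add: cmp_smult_left idm_closed cmp_idm_left)
qed

lemma cmp_smult_idm:
  assumes "f \<in> carrier (homs B b b')" "g \<in> carrier (homs B b b)"
  obtains c where "c \<in> carrier K" "cmp B b b b' f g = c \<odot>\<^bsub>homs B b b'\<^esub> f"
proof -
  obtain c where "c \<in> carrier K" "g = c \<odot>\<^bsub>homs B b b\<^esub> idm B b"
    using assms(2) hom_loop by (auto simp: hom_line_def)
  with assms(1) show thesis
    by (intro that[of c]) (simp_all add: cmp_smult_right idm_closed cmp_idm_right)
qed

lemma cmp_zero_cases:
  assumes "g \<in> carrier (homs B b' b'')" "f \<in> carrier (homs B b b')"
    and "g = \<zero>\<^bsub>homs B b' b''\<^esub> \<or> f = \<zero>\<^bsub>homs B b b'\<^esub>"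
  shows "cmp B b b' b'' g f = \<zero>\<^bsub>homs B b b''\<^esub>"
  using assms by auto

lemma part_zero: "\<zero>\<^bsub>homs B b b'\<^esub> \<in> base_part b b'" "\<zero>\<^bsub>homs B b b'\<^esub> \<in> twist_part b b'"
  using linear_space.submodule_zero[OF linear_space_homs base_part_submodule]
    linear_space.submodule_zero[OF linear_space_homs twist_part_submodule] by blast+

text \<open>
  The only morphism space with a proper base part is the one from \<open>x\<close> to \<open>z\<close>; there, a composite
  through \<open>y\<close> is a multiple of \<open>be al\<close>, and the other factorizations involve a scalar or zero.
\<close>

lemma cmp_base_base:
  assumes g: "g \<in> base_part b' b''" and f: "f \<in> base_part b b'"
  shows "cmp B b b' b'' g f \<in> base_part b b''"
proof (cases "b = Vx \<and> b'' = Vz")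
  case False
  then show ?thesis using g f parts_closed by (auto simp: base_part_def)
next
  case True
  note closed = parts_closed(1)[OF g] parts_closed(1)[OF f]
  show ?thesis
  proof (cases b')
    case Vx
    with True f g closed obtain c where "c \<in> carrier K" "cmp B b b' b'' g f = c \<odot>\<^bsub>homs B b' b''\<^esub> g"
      using cmp_smult_idm by metis
    with g Vx True show ?thesis
      using submodule.smult_closed[OF base_part_submodule] by auto
  next
    case Vz
    with True f g closed obtain c where "c \<in> carrier K" "cmp B b b' b'' g f = c \<odot>\<^bsub>homs B b b'\<^esub> f"
      using smult_idm_cmp by metis
    with f Vz True show ?thesis
      using submodule.smult_closed[OF base_part_submodule] by auto
  next
    case Vz'
    with True closed have "g = \<zero>\<^bsub>homs B b' b''\<^esub>" using hom_trivial by auto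
    with cmp_zero_cases[OF closed] part_zero show ?thesis by simp
  next
    case Vy
    obtain c where c: "c \<in> carrier K" "g = c \<odot>\<^bsub>homs B Vy Vz\<^esub> be"
      using closed(1) Vy True hom_yz by (auto simp: hom_line_def)
    obtain d where d: "d \<in> carrier K" "f = d \<odot>\<^bsub>homs B Vx Vy\<^esub> al"
      using closed(2) Vy True hom_xy by (auto simp: hom_line_def)
    have "cmp B Vx Vy Vz g f = d \<odot>\<^bsub>homs B Vx Vz\<^esub> (c \<odot>\<^bsub>homs B Vx Vz\<^esub> ba)"
      using c d al_closed be_closed by (simp add: cmp_smult_right cmp_smult_left)
    moreover have "ba \<in> base_part Vx Vz"
      using linear_space.line_self[OF linear_space_homs ba_closed] by (simp add: base_part_def)
    ultimately show ?thesis
      using c d Vy True submodule.smult_closed[OF base_part_submodule] by simp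
  qed
qed

lemma twist_part_nonzeroD: "f \<in> twist_part b b' \<Longrightarrow> f \<noteq> \<zero>\<^bsub>homs B b b'\<^esub> \<Longrightarrow> b = Vx \<and> b' = Vz"
  by (auto simp: twist_part_def split: if_splits)

text \<open>
  Starting from \<open>ga\<close> one can only continue with a scalar or with a multiple of \<open>de\<close>, which kills \<open>ga\<close>.
\<close>

lemma cmp_base_twist:
  assumes g: "g \<in> base_part b' b''" and f: "f \<in> twist_part b b'"
  shows "cmp B b b' b'' g f \<in> twist_part b b''"
proof -
  note closed = parts_closed(1)[OF g] parts_closed(2)[OF f]
  consider "f = \<zero>\<^bsub>homs B b b'\<^esub>" | "b = Vx" "b' = Vz" "b'' = Vz" | "b = Vx" "b' = Vz" "b'' = Vz'"
    | "b' = Vz" "b'' \<in> {Vx, Vy}"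
    using twist_part_nonzeroD[OF f] by (cases b'') auto
  then show ?thesis
  proof cases
    case 1
    with cmp_zero_cases[OF closed] part_zero show ?thesis by simp
  next
    case 2
    with closed obtain c where "c \<in> carrier K" "cmp B b b' b'' g f = c \<odot>\<^bsub>homs B b b'\<^esub> f"
      using smult_idm_cmp by metis
    with f 2 show ?thesis
      using submodule.smult_closed[OF twist_part_submodule] by auto
  next
    case 3
    obtain c where c: "c \<in> carrier K" "g = c \<odot>\<^bsub>homs B Vz Vz'\<^esub> de"
      using closed(1) 3 hom_zz' by (auto simp: hom_line_def)
    obtain d where d: "d \<in> carrier K" "f = d \<odot>\<^bsub>homs B Vx Vz\<^esub> ga"
      using f 3 by (auto simp: hom_line_def twist_part_def)
    have "cmp B Vx Vz Vz' g f = \<zero>\<^bsub>homs B Vx Vz'\<^esub>"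
      using c d de_closed ga_closed by (simp add: cmp_smult_right cmp_smult_left de_ga)
    with 3 part_zero show ?thesis by simp
  next
    case 4
    with closed have "g = \<zero>\<^bsub>homs B b' b''\<^esub>" using hom_trivial by auto
    with cmp_zero_cases[OF closed] part_zero show ?thesis by simp
  qed
qed

lemma cmp_twist_base:
  assumes g: "g \<in> twist_part b' b''" and f: "f \<in> base_part b b'"
  shows "cmp B b b' b'' g f \<in> twist_part b b''"
proof -
  note closed = parts_closed(2)[OF g] parts_closed(1)[OF f]
  consider "g = \<zero>\<^bsub>homs B b' b''\<^esub>" | "b = Vx" "b' = Vx" "b'' = Vz" | "b' = Vx" "b \<in> {Vy, Vz, Vz'}"
    using twist_part_nonzeroD[OF g] by (cases b) auto
  then show ?thesis
  proof cases
    case 1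
    with cmp_zero_cases[OF closed] part_zero show ?thesis by simp
  next
    case 2
    with closed obtain c where "c \<in> carrier K" "cmp B b b' b'' g f = c \<odot>\<^bsub>homs B b' b''\<^esub> g"
      using cmp_smult_idm by metis
    with g 2 show ?thesis
      using submodule.smult_closed[OF twist_part_submodule] by auto
  next
    case 3
    with closed have "f = \<zero>\<^bsub>homs B b b'\<^esub>" using hom_trivial by auto
    with cmp_zero_cases[OF closed] part_zero show ?thesis by simp
  qed
qed

text \<open>
  Two non-zero morphisms of the twist part are never composable, since both go from \<open>x\<close> to \<open>z\<close>. So no
  piece of degree \<open>t\<^sup>2\<close> is needed.
\<close>

lemma cmp_twist_twist:
  assumes g: "g \<in> twist_part b' b''" and f: "f \<in> twist_part b b'"
  shows "cmp B b b' b'' g f = \<zero>\<^bsub>homs B b b''\<^esub>"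
  by (rule cmp_zero_cases[OF parts_closed(2)[OF g] parts_closed(2)[OF f]])
    (use twist_part_nonzeroD[OF g] twist_part_nonzeroD[OF f] in auto)

text \<open>
  The products of the two parts are such that degree \<open>1\<close> for the base part and degree \<open>t\<close> for the twist part
  are multiplicative. As \<open>t \<noteq> 1\<close>, the parts are different pieces; all remaining pieces vanish.
\<close>

lemma grading_exists:
  fixes T :: "'t monoid"
  assumes T: "group T" "t \<in> carrier T" "t \<noteq> \<one>\<^bsub>T\<^esub>"
  defines "U \<equiv> \<lparr>sgroup = T, piece = \<lambda>s b b'. if s = \<one>\<^bsub>T\<^esub> then base_part b b'
      else if s = t then twist_part b b' else {\<zero>\<^bsub>homs B b b'\<^esub>}\<rparr>"
  shows "k_grading K B U"
proof -
  interpret T: group T by fact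
  show ?thesis
  proof (intro k_grading.intro k_category_axioms k_grading_axioms.intro)
    show "group (sgroup U)" by (simp add: U_def T)
    show "is_direct_sum K (homs B b b') (carrier (sgroup U)) (\<lambda>s. piece U s b b')" for b b'
      using linear_space.is_direct_sum_pair[OF linear_space_homs _ _ _ base_part_submodule
          twist_part_submodule parts_disjoint parts_decompose, of "\<one>\<^bsub>T\<^esub>" "carrier T" t b b'] T
      by (simp add: U_def)
    show "cmp B b b' b'' g f \<in> piece U (s' \<otimes>\<^bsub>sgroup U\<^esub> s) b b''"
      if s: "s \<in> carrier (sgroup U)" "s' \<in> carrier (sgroup U)"
        and g: "g \<in> piece U s' b' b''" and f: "f \<in> piece U s b b'" for b b' b'' s s' g f
    proof -
      have zero: "\<zero>\<^bsub>homs B b b''\<^esub> \<in> piece U r b b''" for r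
        using part_zero by (simp add: U_def)
      have piece: "(r = \<one>\<^bsub>T\<^esub> \<and> h \<in> base_part v v') \<or> (r = t \<and> h \<in> twist_part v v') \<or> h = \<zero>\<^bsub>homs B v v'\<^esub>"
        if "h \<in> piece U r v v'" for h r v v'
        using that by (auto simp: U_def split: if_splits)
      have closed: "h \<in> carrier (homs B v v')" if "h \<in> piece U r v v'" for h r v v'
        using piece[OF that] parts_closed by auto
      have "cmp B b b' b'' g f = \<zero>\<^bsub>homs B b b''\<^esub>" if "g = \<zero>\<^bsub>homs B b' b''\<^esub> \<or> f = \<zero>\<^bsub>homs B b b'\<^esub>"
        using cmp_zero_cases closed[OF g] closed[OF f] that by blast
      with piece[OF g] piece[OF f] cmp_base_base[of g b' b'' f b] cmp_base_twist[of g b' b'' f b]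
        cmp_twist_base[of g b' b'' f b] cmp_twist_twist[of g b' b'' f b] zero s T
      show ?thesis
        by (elim disjE conjE) (simp_all add: U_def)
    qed
  qed
qed

end

section \<open>Degrees of the generators in an arbitrary grading\<close>

context k_grading
begin

lemma piece_submodule:
  "b \<in> objs B \<Longrightarrow> b' \<in> objs B \<Longrightarrow> s \<in> carrier (sgroup X) \<Longrightarrow> submodule (piece X s b b') K (homs B b b')"
  using direct_sum_submodule[OF piece_direct_sum] .

lemma piece_unique:
  assumes "b \<in> objs B" "b' \<in> objs B" "s \<in> carrier (sgroup X)" "s' \<in> carrier (sgroup X)"
    and "f \<in> piece X s b b'" "f \<in> piece X s' b b'" "f \<noteq> \<zero>\<^bsub>homs B b b'\<^esub>"
  shows "s = s'"
  using linear_space.direct_sum_disjoint[OF hom_space piece_direct_sum] assms by blast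

lemma degree_eq:
  assumes "b \<in> objs B" "b' \<in> objs B" "s \<in> carrier (sgroup X)"
    and "f \<in> piece X s b b'" "f \<noteq> \<zero>\<^bsub>homs B b b'\<^esub>"
  shows "degree B X b b' f = s"
  unfolding degree_def homogeneous_of_degree_def
  using assms piece_unique by (intro the_equality) blast+

lemma homogeneousI:
  "s \<in> carrier (sgroup X) \<Longrightarrow> f \<in> piece X s b b' \<Longrightarrow> f \<noteq> \<zero>\<^bsub>homs B b b'\<^esub> \<Longrightarrow> homogeneous B X b b' f"
  by (auto simp: homogeneous_def homogeneous_of_degree_def)

text \<open>
  An identity that spans its loops is homogeneous of some degree \<open>s\<close>, and being idempotent it forces
  \<open>s = s\<^sup>2\<close>. The zero morphism, which lies in every piece, has to be treated separately.
\<close>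

lemma idm_piece:
  assumes b: "b \<in> objs B" and line: "carrier (homs B b b) = hom_line b b (idm B b)"
  shows "idm B b \<in> piece X \<one>\<^bsub>sgroup X\<^esub> b b"
proof -
  obtain s where s: "s \<in> carrier (sgroup X)" "idm B b \<in> piece X s b b"
    using linear_space.direct_sum_line_homogeneous[OF hom_space[OF b b] piece_direct_sum[OF b b] _ idm_closed[OF b] line]
    by blast
  show ?thesis
  proof (cases "idm B b = \<zero>\<^bsub>homs B b b\<^esub>")
    case True
    then show ?thesis
      using linear_space.submodule_zero[OF hom_space piece_submodule] b by simp
  next
    case False
    have "idm B b \<in> piece X (s \<otimes>\<^bsub>sgroup X\<^esub> s) b b"
      using piece_cmp[OF b b b s(1,1,2,2)] b by (simp add: cmp_idm_left idm_closed)
    then have "s = s \<otimes>\<^bsub>sgroup X\<^esub> s"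
      using piece_unique[OF b b s(1)] s False by blast
    then have "s = \<one>\<^bsub>sgroup X\<^esub>" using s(1) by simp
    with s show ?thesis by simp
  qed
qed

end

context triangle_with_tail
begin

text \<open>
  A component of \<open>ga\<close> whose degree differs from that of \<open>be al\<close> is sent by \<open>de\<close> to a morphism whose degree
  differs from that of \<open>de be al\<close>. As the latter spans its morphism space, the image is zero, so the component
  lies on the line of \<open>ga\<close>. If there is no such non-zero component, then \<open>ga\<close> is its own component in the
  degree of \<open>be al\<close>.
\<close>

lemma ga_homogeneous:
  assumes "k_grading K B X"
    and a: "a \<in> carrier (sgroup X)" "al \<in> piece X a Vx Vy"
    and b: "b \<in> carrier (sgroup X)" "be \<in> piece X b Vy Vz"
    and d: "d \<in> carrier (sgroup X)" "de \<in> piece X d Vz Vz'"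
  obtains c where "c \<in> carrier (sgroup X)" "ga \<in> piece X c Vx Vz"
proof -
  interpret X: k_grading K B X by fact
  let ?S = "carrier (sgroup X)"
  have dba: "dba \<in> piece X (d \<otimes>\<^bsub>sgroup X\<^esub> (b \<otimes>\<^bsub>sgroup X\<^esub> a)) Vx Vz'"
    using a b d by (intro X.piece_cmp) simp_all
  obtain c where c: "\<And>s. s \<in> ?S \<Longrightarrow> c s \<in> piece X s Vx Vz" "\<exists>s\<in>?S. c s \<noteq> \<zero>\<^bsub>homs B Vx Vz\<^esub>"
    and only: "\<And>r. r \<in> ?S \<Longrightarrow> (\<And>s. s \<in> ?S \<Longrightarrow> s \<noteq> r \<Longrightarrow> c s = \<zero>\<^bsub>homs B Vx Vz\<^esub>) \<Longrightarrow> ga = c r"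
    using linear_space.direct_sum_component[OF linear_space_homs X.piece_direct_sum ga_closed] ga_nonzero
    by (metis objs_eq UNIV_I)
  have ba_deg: "b \<otimes>\<^bsub>sgroup X\<^esub> a \<in> ?S" using a b by simp
  show thesis
  proof (cases "\<exists>s\<in>?S. s \<noteq> b \<otimes>\<^bsub>sgroup X\<^esub> a \<and> c s \<noteq> \<zero>\<^bsub>homs B Vx Vz\<^esub>")
    case False
    with only[OF ba_deg] c(1)[OF ba_deg] ba_deg show thesis
      by (intro that[of "b \<otimes>\<^bsub>sgroup X\<^esub> a"]) auto
  next
    case True
    then obtain s where s: "s \<in> ?S" "s \<noteq> b \<otimes>\<^bsub>sgroup X\<^esub> a" "c s \<noteq> \<zero>\<^bsub>homs B Vx Vz\<^esub>" by blast
    note sub = X.piece_submodule[of Vx Vz, OF _ _ s(1), simplified]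
    have closed: "c s \<in> carrier (homs B Vx Vz)"
      using linear_space.submodule_closed[OF linear_space_homs sub c(1)[OF s(1)]] .
    let ?f = "cmp B Vx Vz Vz' de (c s)"
    have f: "?f \<in> piece X (d \<otimes>\<^bsub>sgroup X\<^esub> s) Vx Vz'"
      using d s c(1) by (intro X.piece_cmp) simp_all
    have "?f \<in> carrier (homs B Vx Vz')" using closed de_closed by blast
    then have f_line: "?f \<in> hom_line Vx Vz' dba" using hom_xz' by simp
    have "?f = \<zero>\<^bsub>homs B Vx Vz'\<^esub>"
    proof (rule ccontr)
      assume nz: "?f \<noteq> \<zero>\<^bsub>homs B Vx Vz'\<^esub>"
      have "dba \<in> carrier (homs B Vx Vz')" using ba_closed de_closed by blast
      then have "dba \<in> piece X (d \<otimes>\<^bsub>sgroup X\<^esub> s) Vx Vz'"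
        using linear_space.generator_in_submodule[OF linear_space_homs X.piece_submodule _ f_line nz f] d s by simp
      then have "d \<otimes>\<^bsub>sgroup X\<^esub> s = d \<otimes>\<^bsub>sgroup X\<^esub> (b \<otimes>\<^bsub>sgroup X\<^esub> a)"
        using X.piece_unique[OF _ _ _ _ _ dba path_nonzero] d s ba_deg by simp
      with s(2) show False using d(1) s(1) ba_deg by simp
    qed
    then have "c s \<in> hom_line Vx Vz ga" by (rule kernel_de[OF closed])
    then have "ga \<in> piece X s Vx Vz"
      using linear_space.generator_in_submodule[OF linear_space_homs sub ga_closed _ s(3) c(1)[OF s(1)]] by blast
    with s(1) show thesis by (rule that)
  qed
qed

lemma generators_homogeneous:
  assumes X: "k_grading K B X"
  obtains a b c d where
    "a \<in> carrier (sgroup X)" "al \<in> piece X a Vx Vy"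
    "b \<in> carrier (sgroup X)" "be \<in> piece X b Vy Vz"
    "c \<in> carrier (sgroup X)" "ga \<in> piece X c Vx Vz"
    "d \<in> carrier (sgroup X)" "de \<in> piece X d Vz Vz'"
proof -
  interpret X: k_grading K B X by fact
  have arrow: "\<exists>s\<in>carrier (sgroup X). e \<in> piece X s v v'"
    if "e \<in> carrier (homs B v v')" "carrier (homs B v v') = hom_line v v' e" for e v v'
    using linear_space.direct_sum_line_homogeneous[OF linear_space_homs X.piece_direct_sum _ that] X.one_closed
    by (metis empty_iff objs_eq UNIV_I)
  obtain a b d where abd: "a \<in> carrier (sgroup X)" "al \<in> piece X a Vx Vy"
    "b \<in> carrier (sgroup X)" "be \<in> piece X b Vy Vz"
    "d \<in> carrier (sgroup X)" "de \<in> piece X d Vz Vz'"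
    using arrow[OF al_closed hom_xy] arrow[OF be_closed hom_yz] arrow[OF de_closed hom_zz'] by blast
  obtain c where "c \<in> carrier (sgroup X)" "ga \<in> piece X c Vx Vz"
    using ga_homogeneous[OF X abd] .
  with abd show thesis by (intro that)
qed

end

text \<open>
  An arbitrary grading together with the degrees of the four generators; by \<open>generators_homogeneous\<close>
  every grading is of this form.
\<close>

locale graded_triangle = triangle_with_tail K B al be ga de + X: k_grading K B X
  for K :: "('k, 'c) ring_scheme" (structure) and B :: "('k, vertex, 'm) kcat"
    and al be ga de and X :: "('g, vertex, 'm) grading" +
  fixes a b c d
  assumes al_deg: "a \<in> carrier (sgroup X)" "al \<in> piece X a Vx Vy"
    and be_deg: "b \<in> carrier (sgroup X)" "be \<in> piece X b Vy Vz"
    and ga_deg: "c \<in> carrier (sgroup X)" "ga \<in> piece X c Vx Vz"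
    and de_deg: "d \<in> carrier (sgroup X)" "de \<in> piece X d Vz Vz'"
begin

abbreviation G where "G \<equiv> sgroup X"

text \<open>
  A potential for the degrees of \<open>al\<close>, \<open>be\<close> and \<open>de\<close>: the degree of each of them is the quotient of the
  potentials at its target and its source. It is normalized to be trivial at the base object.
\<close>

definition pot :: "vertex \<Rightarrow> 'g" where
  "pot v = (case v of Vx \<Rightarrow> \<one>\<^bsub>G\<^esub> | Vy \<Rightarrow> a | Vz \<Rightarrow> b \<otimes>\<^bsub>G\<^esub> a | Vz' \<Rightarrow> d \<otimes>\<^bsub>G\<^esub> (b \<otimes>\<^bsub>G\<^esub> a))"

text \<open>
  The degree of the closed walk at \<open>x\<close> that traverses \<open>ga\<close> and returns along \<open>be\<close> and \<open>al\<close> backwards.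
\<close>

definition twist :: 'g where
  "twist = inv\<^bsub>G\<^esub> (b \<otimes>\<^bsub>G\<^esub> a) \<otimes>\<^bsub>G\<^esub> c"

lemma pot_closed [simp]: "pot v \<in> carrier G"
  using al_deg be_deg de_deg by (simp add: pot_def split: vertex.split)

lemma twist_closed [simp]: "twist \<in> carrier G"
  using al_deg be_deg ga_deg by (simp add: twist_def)

lemma line_piece:
  assumes "e \<in> piece X s v v'" "s \<in> carrier G" "f \<in> hom_line v v' e"
  shows "f \<in> piece X s v v'"
  using linear_space.line_subset_submodule[OF linear_space_homs X.piece_submodule assms(1)] assms by auto

text \<open>
  Up to the potential, all morphisms built from \<open>al\<close>, \<open>be\<close>, \<open>de\<close> have trivial degree.
\<close>

lemma base_part_piece:
  assumes f: "f \<in> base_part v v'"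
  shows "f \<in> piece X (pot v' \<otimes>\<^bsub>G\<^esub> inv\<^bsub>G\<^esub> pot v) v v'"
proof -
  note deg = al_deg be_deg de_deg
  let ?s = "pot v' \<otimes>\<^bsub>G\<^esub> inv\<^bsub>G\<^esub> pot v"
  have cancel: "(g \<otimes>\<^bsub>G\<^esub> h) \<otimes>\<^bsub>G\<^esub> inv\<^bsub>G\<^esub> h = g" if "g \<in> carrier G" "h \<in> carrier G" for g h
    using that by (simp add: X.m_assoc)
  have ba: "ba \<in> piece X (b \<otimes>\<^bsub>G\<^esub> a) Vx Vz"
    using deg by (intro X.piece_cmp) simp_all
  have db: "db \<in> piece X (d \<otimes>\<^bsub>G\<^esub> b) Vy Vz'"
    using deg by (intro X.piece_cmp) simp_all
  have dba: "dba \<in> piece X (d \<otimes>\<^bsub>G\<^esub> (b \<otimes>\<^bsub>G\<^esub> a)) Vx Vz'"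
    using deg ba by (intro X.piece_cmp) simp_all
  have "\<exists>e. e \<in> piece X ?s v v' \<and> f \<in> hom_line v v' e" if ne: "f \<noteq> \<zero>\<^bsub>homs B v v'\<^esub>"
  proof -
    have closed: "f \<in> carrier (homs B v v')" using f by (rule parts_closed)
    with ne have nontrivial:
      "(v, v') \<notin> {(Vy, Vx), (Vz, Vx), (Vz', Vx), (Vz, Vy), (Vz', Vy), (Vz', Vz)}"
      using hom_trivial by blast
    show ?thesis
    proof (cases "v = v'")
      case True
      then show ?thesis
        using closed hom_loop X.idm_piece[of v] by (intro exI[of _ "idm B v"]) simp
    next
      case False
      then consider "v = Vx" "v' = Vy" | "v = Vy" "v' = Vz" | "v = Vz" "v' = Vz'" | "v = Vy" "v' = Vz'"
        | "v = Vx" "v' = Vz'" | "v = Vx" "v' = Vz"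
        using nontrivial by (cases v; cases v') auto
      then show ?thesis
      proof cases
        case 1
        with closed deg hom_xy show ?thesis by (intro exI[of _ al]) (simp add: pot_def)
      next
        case 2
        with closed deg hom_yz show ?thesis by (intro exI[of _ be]) (simp add: pot_def cancel)
      next
        case 3
        with closed deg hom_zz' show ?thesis by (intro exI[of _ de]) (simp add: pot_def cancel)
      next
        case 4
        with closed deg hom_yz' db show ?thesis
          by (intro exI[of _ db]) (simp add: pot_def cancel flip: X.m_assoc)
      next
        case 5
        with closed deg hom_xz' dba show ?thesis by (intro exI[of _ dba]) (simp add: pot_def)
      next
        case 6
        with f deg ba show ?thesis by (intro exI[of _ ba]) (simp add: pot_def base_part_def)
      qed
    qed
  qed
  then show ?thesis
    using line_piece[of _ ?s] linear_space.submodule_zero[OF linear_space_homs X.piece_submodule, of v v' ?s]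
    by auto
qed

lemma twist_part_piece:
  assumes f: "f \<in> twist_part v v'"
  shows "f \<in> piece X (pot v' \<otimes>\<^bsub>G\<^esub> twist \<otimes>\<^bsub>G\<^esub> inv\<^bsub>G\<^esub> pot v) v v'"
proof (cases "v = Vx \<and> v' = Vz")
  case True
  have "b \<otimes>\<^bsub>G\<^esub> a \<otimes>\<^bsub>G\<^esub> twist = c"
    using al_deg be_deg ga_deg by (simp add: twist_def X.m_assoc[symmetric])
  with True f ga_deg line_piece[of ga c] show ?thesis
    by (simp add: pot_def twist_part_def)
next
  case False
  with f show ?thesis
    using linear_space.submodule_zero[OF linear_space_homs X.piece_submodule, of v v']
    by (auto simp: twist_part_def)
qed

text \<open>
  This carries the uniqueness of morphisms of gradings. An automorphism rescales \<open>al\<close> and \<open>be\<close>, which span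
  their spaces, and it rescales \<open>ga\<close>, which spans the kernel of composition with \<open>de\<close>. Since scalars do not
  affect degrees, the image of the loop has the same degree for all \<open>J\<close>.
\<close>

lemma loop_degree:
  assumes "k_automorphism K B J"
  shows "walk_degree B X (map_walk J [(Vx, Vy, al, -1), (Vy, Vz, be, -1), (Vx, Vz, ga, 1)]) = twist"
proof -
  interpret J: k_automorphism K B J by fact
  have zero: "J v v' \<zero>\<^bsub>homs B v v'\<^esub> = \<zero>\<^bsub>homs B v v'\<^esub>" for v v'
    using J.J_smult[of v v' \<zero> "\<zero>\<^bsub>homs B v v'\<^esub>"] J.J_bij[of v v', THEN bij_betwE]
      module.smult_l_null[OF module_homs] by simp
  have closed: "J v v' f \<in> carrier (homs B v v')" if "f \<in> carrier (homs B v v')" for f v v'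
    using J.J_bij[of v v', THEN bij_betwE] that by simp
  have nonzero: "J v v' f \<noteq> \<zero>\<^bsub>homs B v v'\<^esub>"
    if "f \<in> carrier (homs B v v')" "f \<noteq> \<zero>\<^bsub>homs B v v'\<^esub>" for f v v'
    using bij_betw_imp_inj_on[OF J.J_bij[of v v']] that zero[of v v']
    by (metis inj_onD objs_eq UNIV_I zero_closed)
  have al: "degree B X Vx Vy (J Vx Vy al) = a"
    using X.degree_eq[OF _ _ al_deg(1) line_piece[OF al_deg(2,1)] nonzero]
      closed[OF al_closed] al_closed hom_xy generators_nonzero
    by simp
  have be: "degree B X Vy Vz (J Vy Vz be) = b"
    using X.degree_eq[OF _ _ be_deg(1) line_piece[OF be_deg(2,1)] nonzero]
      closed[OF be_closed] be_closed hom_yz generators_nonzero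
    by simp
  have "cmp B Vx Vz Vz' (J Vz Vz' de) (J Vx Vz ga) = \<zero>\<^bsub>homs B Vx Vz'\<^esub>"
    using J.J_cmp[of Vx Vz Vz' de ga] de_closed ga_closed by (simp add: de_ga zero)
  moreover obtain e where e: "e \<in> carrier K" "J Vz Vz' de = e \<odot>\<^bsub>homs B Vz Vz'\<^esub> de"
    using closed[OF de_closed] hom_zz' by (auto simp: hom_line_def)
  ultimately have "e \<odot>\<^bsub>homs B Vx Vz'\<^esub> cmp B Vx Vz Vz' de (J Vx Vz ga) = \<zero>\<^bsub>homs B Vx Vz'\<^esub>"
    using closed[OF ga_closed] de_closed by (simp add: cmp_smult_left)
  moreover have "e \<noteq> \<zero>"
    using e nonzero[OF de_closed] generators_nonzero module.smult_l_null[OF module_homs de_closed] by auto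
  ultimately have "cmp B Vx Vz Vz' de (J Vx Vz ga) = \<zero>\<^bsub>homs B Vx Vz'\<^esub>"
    using smult_eq_zeroD[OF e(1)] closed[OF ga_closed] de_closed by blast
  then have "J Vx Vz ga \<in> hom_line Vx Vz ga"
    by (rule kernel_de[OF closed[OF ga_closed]])
  then have ga: "degree B X Vx Vz (J Vx Vz ga) = c"
    using X.degree_eq[OF _ _ ga_deg(1) line_piece[OF ga_deg(2,1)] nonzero] ga_closed ga_nonzero
    by auto
  have minus_one: "g [^]\<^bsub>G\<^esub> (- 1 :: int) = inv\<^bsub>G\<^esub> g" "g [^]\<^bsub>G\<^esub> (1 :: int) = g" if "g \<in> carrier G" for g
    using that X.int_pow_neg[of g 1] X.int_pow_1[of g] by simp_all
  show ?thesis
    using al_deg be_deg ga_deg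
    by (simp add: map_walk_def walk_degree_def al be ga minus_one twist_def X.inv_mult_group X.m_assoc)
qed

end

section \<open>Walks and universality\<close>

context k_grading
begin

lemma homogeneous_degree:
  assumes "b \<in> objs B" "b' \<in> objs B" "homogeneous B X b b' f"
  shows "degree B X b b' f \<in> carrier (sgroup X)" "f \<in> piece X (degree B X b b' f) b b'"
proof -
  obtain s where "s \<in> carrier (sgroup X)" "f \<in> piece X s b b'" "f \<noteq> \<zero>\<^bsub>homs B b b'\<^esub>"
    using assms(3) by (auto simp: homogeneous_def homogeneous_of_degree_def)
  with assms(1,2) show "degree B X b b' f \<in> carrier (sgroup X)" "f \<in> piece X (degree B X b b' f) b b'"
    using degree_eq by auto
qed

lemma vdegree_closed:
  "vmor_ok B v \<Longrightarrow> vhomogeneous B X v \<Longrightarrow> vdegree B X v \<in> carrier (sgroup X)"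
  using homogeneous_degree(1) by (cases v) auto

lemma walk_degree_Cons [simp]:
  "walk_degree B X (v # w) = vdegree B X v \<otimes>\<^bsub>sgroup X\<^esub> walk_degree B X w"
  by (simp add: walk_degree_def)

lemma walk_degree_Nil [simp]: "walk_degree B X [] = \<one>\<^bsub>sgroup X\<^esub>"
  by (simp add: walk_degree_def)

lemma walk_degree_closed:
  "\<forall>v\<in>set w. vmor_ok B v \<and> vhomogeneous B X v \<Longrightarrow> walk_degree B X w \<in> carrier (sgroup X)"
  using vdegree_closed by (induction w) auto

lemma walk_degree_append:
  assumes "\<forall>v\<in>set (w' @ w). vmor_ok B v \<and> vhomogeneous B X v"
  shows "walk_degree B X (w' @ w) = walk_degree B X w' \<otimes>\<^bsub>sgroup X\<^esub> walk_degree B X w"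
  using assms by (induction w') (auto simp: m_assoc vdegree_closed walk_degree_closed)

lemma HW_Cons:
  assumes "v # w \<in> HW B X b b'"
  shows "vmor_ok B v" "vhomogeneous B X v" "vtgt v = b'"
    "w = [] \<and> vsrc v = b \<or> w \<noteq> [] \<and> w \<in> HW B X b (vsrc v)"
  using assms by (auto simp: HW_def walks_def successively_Cons split: if_splits)

lemma HW_append:
  assumes "w \<in> HW B X b b'" "w' \<in> HW B X b' b''"
  shows "w' @ w \<in> HW B X b b''"
  using assms by (auto simp: HW_def walks_def successively_append_iff)

text \<open>
  Being joined by a homogeneous walk of a given degree is compatible with composition of walks, so that
  connectedness can be derived from walks that consist of a single virtual morphism.
\<close>

definition connects :: "'o \<Rightarrow> 'o \<Rightarrow> 'g \<Rightarrow> bool" where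
  "connects b b' s \<longleftrightarrow> s \<in> walk_degree B X ` HW B X b b'"

lemma connects_trans:
  assumes "connects b b' s" "connects b' b'' s'"
  shows "connects b b'' (s' \<otimes>\<^bsub>sgroup X\<^esub> s)"
proof -
  obtain w w' where w: "w \<in> HW B X b b'" "s = walk_degree B X w"
    and w': "w' \<in> HW B X b' b''" "s' = walk_degree B X w'"
    using assms by (auto simp: connects_def)
  have "\<forall>v\<in>set (w' @ w). vmor_ok B v \<and> vhomogeneous B X v"
    using w(1) w'(1) by (auto simp: HW_def walks_def)
  from walk_degree_append[OF this] HW_append[OF w(1) w'(1)] w(2) w'(2) show ?thesis
    unfolding connects_def by (metis image_eqI)
qed

lemma int_pow_unit: "g \<in> carrier (sgroup X) \<Longrightarrow> g [^]\<^bsub>sgroup X\<^esub> (1 :: int) = g"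
  "g \<in> carrier (sgroup X) \<Longrightarrow> g [^]\<^bsub>sgroup X\<^esub> (- 1 :: int) = inv\<^bsub>sgroup X\<^esub> g"
  using int_pow_neg[of g 1] int_pow_1[of g] by simp_all

lemma connects_arrow:
  assumes "b \<in> objs B" "b' \<in> objs B" "s \<in> carrier (sgroup X)" "f \<in> piece X s b b'" "f \<noteq> \<zero>\<^bsub>homs B b b'\<^esub>"
  shows "connects b b' s" "connects b' b (inv\<^bsub>sgroup X\<^esub> s)"
proof -
  have f: "f \<in> carrier (homs B b b')"
    using linear_space.submodule_closed[OF hom_space piece_submodule] assms by blast
  have "[(b, b', f, 1)] \<in> HW B X b b'" "[(b, b', f, - 1)] \<in> HW B X b' b"
    using assms f homogeneousI by (simp_all add: HW_def walks_def)
  then show "connects b b' s" "connects b' b (inv\<^bsub>sgroup X\<^esub> s)"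
    using assms degree_eq unfolding connects_def by (auto simp: int_pow_unit intro!: image_eqI[rotated])
qed

end

text \<open>
  The grading of the theorem: its group is freely generated by \<open>t\<close>, the degree of \<open>ga\<close>, and the other
  generators have trivial degree. In particular its potential is trivial and its twist is \<open>t\<close>.
\<close>

locale twisted_triangle =
  graded_triangle K B al be ga de U "\<one>\<^bsub>sgroup U\<^esub>" "\<one>\<^bsub>sgroup U\<^esub>" t "\<one>\<^bsub>sgroup U\<^esub>"
  for K :: "('k, 'c) ring_scheme" (structure) and B :: "('k, vertex, 'm) kcat"
    and al be ga de and U :: "('t, vertex, 'm) grading" and t +
  assumes powers: "carrier (sgroup U) = range (\<lambda>k :: int. t [^]\<^bsub>sgroup U\<^esub> k)"
    and powers_inj: "inj (\<lambda>k :: int. t [^]\<^bsub>sgroup U\<^esub> k)"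
begin

lemma t_closed [simp]: "t \<in> carrier G" by (rule ga_deg)

lemma t_ne_one: "t \<noteq> \<one>\<^bsub>G\<^esub>"
  using injD[OF powers_inj, of 1 0] X.int_pow_1[OF t_closed] by auto

lemma base_part_U: "f \<in> base_part v v' \<Longrightarrow> f \<in> piece U \<one>\<^bsub>G\<^esub> v v'"
  using base_part_piece[of f v v'] by (cases v; cases v') (simp_all add: pot_def)

lemma twist_part_U: "f \<in> twist_part v v' \<Longrightarrow> f \<in> piece U t v v'"
  using twist_part_piece[of f v v'] by (cases v; cases v') (simp_all add: pot_def twist_def)

text \<open>
  The base and twist part lie in the pieces of the distinct degrees \<open>1\<close> and \<open>t\<close> and together span, so
  there are no other homogeneous morphisms.
\<close>

lemma homogeneous_cases:
  assumes f: "homogeneous B U v v' f"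
  shows "degree B U v v' f = \<one>\<^bsub>G\<^esub> \<and> f \<in> base_part v v' \<or> degree B U v v' f = t \<and> f \<in> twist_part v v'"
proof -
  note deg = X.homogeneous_degree[OF _ _ f, simplified]
  have nz: "f \<noteq> \<zero>\<^bsub>homs B v v'\<^esub>"
    using f by (auto simp: homogeneous_def homogeneous_of_degree_def)
  have closed: "f \<in> carrier (homs B v v')"
    using linear_space.submodule_closed[OF linear_space_homs X.piece_submodule deg(2)] deg(1) by simp
  then obtain u u' where u: "u \<in> base_part v v'" "u' \<in> twist_part v v'" "f = u \<oplus>\<^bsub>homs B v v'\<^esub> u'"
    using parts_decompose by blast
  have "(u = \<zero>\<^bsub>homs B v v'\<^esub> \<or> degree B U v v' f = \<one>\<^bsub>G\<^esub>) \<and> (u' = \<zero>\<^bsub>homs B v v'\<^esub> \<or> degree B U v v' f = t)"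
    using linear_space.direct_sum_pair_unique[OF linear_space_homs X.piece_direct_sum[of v v'],
        of "\<one>\<^bsub>G\<^esub>" t "degree B U v v' f" u u'] deg t_ne_one base_part_U[OF u(1)] twist_part_U[OF u(2)] u(3)
    by auto
  then show ?thesis
    using u nz t_ne_one parts_closed[of _ v v'] by auto
qed

text \<open>
  Walks along \<open>al\<close>, \<open>be\<close>, \<open>de\<close> connect all objects in trivial degree, and the powers of the loop through
  \<open>ga\<close> at \<open>x\<close> realize the powers of \<open>t\<close>.
\<close>

lemma connected: "connected_k_grading K B U"
proof (intro connected_k_grading.intro X.k_grading_axioms connected_k_grading_axioms.intro)
  note generators = al_closed be_closed de_closed ga_closed
  have al: "X.connects Vx Vy \<one>\<^bsub>G\<^esub>" "X.connects Vy Vx \<one>\<^bsub>G\<^esub>"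
    using X.connects_arrow[of Vx Vy "\<one>\<^bsub>G\<^esub>" al] al_deg generators_nonzero by simp_all
  have be: "X.connects Vy Vz \<one>\<^bsub>G\<^esub>" "X.connects Vz Vy \<one>\<^bsub>G\<^esub>"
    using X.connects_arrow[of Vy Vz "\<one>\<^bsub>G\<^esub>" be] be_deg generators_nonzero by simp_all
  have de: "X.connects Vz Vz' \<one>\<^bsub>G\<^esub>" "X.connects Vz' Vz \<one>\<^bsub>G\<^esub>"
    using X.connects_arrow[of Vz Vz' "\<one>\<^bsub>G\<^esub>" de] de_deg generators_nonzero by simp_all
  have ga: "X.connects Vx Vz t" "X.connects Vz Vx (inv\<^bsub>G\<^esub> t)"
    using X.connects_arrow[of Vx Vz t ga] ga_deg ga_nonzero by simp_all
  have from_x: "X.connects Vx v \<one>\<^bsub>G\<^esub>" for v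
    using X.connects_trans[OF al] al(1) X.connects_trans[OF al(1) be(1)]
      X.connects_trans[OF X.connects_trans[OF al(1) be(1)] de(1)] by (cases v) simp_all
  have to_x: "X.connects v Vx \<one>\<^bsub>G\<^esub>" for v
    using X.connects_trans[OF al] al(2) X.connects_trans[OF be(2) al(2)]
      X.connects_trans[OF de(2) X.connects_trans[OF be(2) al(2)]] by (cases v) simp_all
  have loop: "X.connects Vx Vx t" "X.connects Vx Vx (inv\<^bsub>G\<^esub> t)"
    using X.connects_trans[OF ga(1) to_x[of Vz]] X.connects_trans[OF from_x[of Vz] ga(2)] by simp_all
  have "X.connects Vx Vx (t [^]\<^bsub>G\<^esub> k)" for k :: int
  proof (induction k rule: int_induct[where k = 0])
    case base
    show ?case using from_x[of Vx] by simp
  next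
    case (step1 i)
    from X.connects_trans[OF step1(2) loop(1)] show ?case
      using X.int_pow_mult[of t 1 i] X.int_pow_unit(1)[of t] by (simp add: add.commute)
  next
    case (step2 i)
    from X.connects_trans[OF step2(2) loop(2)] show ?case
      using X.int_pow_mult[of t "- 1" i] X.int_pow_unit(2)[of t] by (simp add: add.commute)
  qed
  then have "X.connects Vx Vx s" if "s \<in> carrier G" for s
    using that powers by auto
  then have "X.connects v v' s" if "s \<in> carrier G" for v v' s
    using X.connects_trans[OF X.connects_trans[OF to_x[of v]] from_x[of v']] that by fastforce
  then show "carrier G \<subseteq> walk_degree B U ` HW B U v v'" for v v'
    by (auto simp: X.connects_def)
qed

text \<open>
  A homogeneous morphism of the universal grading has degree \<open>1\<close> or \<open>t\<close>, hence in \<open>Y\<close> its degree is the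
  \<open>mu\<close>-image of that degree between the potential at its target and the inverse of the potential at its
  source. Along a walk the intermediate potentials cancel. On walks closed at the base object the potentials disappear, and what
  remains is the condition for \<open>mu\<close> to be a morphism of gradings with the identity automorphism.
\<close>

lemma walk_degree_telescope:
  assumes Y: "graded_triangle K B al be ga de Y a b c d"
    and mu: "mu \<in> hom G (sgroup Y)" "mu t = graded_triangle.twist Y a b c"
    and w: "w \<in> HW B U v v'"
  shows "walk_degree B Y w = graded_triangle.pot Y a b d v' \<otimes>\<^bsub>sgroup Y\<^esub> mu (walk_degree B U w)
    \<otimes>\<^bsub>sgroup Y\<^esub> inv\<^bsub>sgroup Y\<^esub> graded_triangle.pot Y a b d v"
proof -
  interpret Y: graded_triangle K B al be ga de Y a b c d by (rule Y)
  interpret mu: group_hom G Y.G mu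
    using mu(1) by (simp add: group_hom_def group_hom_axioms_def X.group_axioms Y.X.group_axioms)
  have mor: "degree B Y p p' f = Y.pot p' \<otimes>\<^bsub>Y.G\<^esub> mu (degree B U p p' f) \<otimes>\<^bsub>Y.G\<^esub> inv\<^bsub>Y.G\<^esub> Y.pot p"
    if f: "homogeneous B U p p' f" for p p' f
  proof -
    have "f \<noteq> \<zero>\<^bsub>homs B p p'\<^esub>"
      using f by (auto simp: homogeneous_def homogeneous_of_degree_def)
    with homogeneous_cases[OF f] Y.base_part_piece[of f p p'] Y.twist_part_piece[of f p p'] mu(2)
    show ?thesis
      by (auto intro!: Y.X.degree_eq)
  qed
  have virtual: "vdegree B Y u = Y.pot (vtgt u) \<otimes>\<^bsub>Y.G\<^esub> mu (vdegree B U u) \<otimes>\<^bsub>Y.G\<^esub> inv\<^bsub>Y.G\<^esub> Y.pot (vsrc u)"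
    if u: "vmor_ok B u" "vhomogeneous B U u" for u
  proof -
    obtain p p' f e where ue: "u = (p, p', f, e)" by (cases u) auto
    have f: "homogeneous B U p p' f" and e: "e = 1 \<or> e = - 1" using u ue by auto
    note deg = X.homogeneous_degree(1)[OF _ _ f, simplified]
    from e show ?thesis
    proof
      assume "e = 1"
      then show ?thesis using ue deg mor[OF f] by (simp add: X.int_pow_unit Y.X.int_pow_unit)
    next
      assume "e = - 1"
      then show ?thesis using ue deg mor[OF f]
        by (simp add: X.int_pow_unit Y.X.int_pow_unit Y.X.inv_mult_group Y.X.m_assoc)
    qed
  qed
  show ?thesis
    using w
  proof (induction w arbitrary: v')
    case Nil
    then show ?case by (simp add: HW_def walks_def)
  next
    case (Cons u w)
    note u = X.HW_Cons[OF Cons.prems]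
    note closed = X.vdegree_closed[OF u(1,2)]
    from u(4) show ?case
    proof
      assume "w = [] \<and> vsrc u = v"
      then show ?thesis using u(3) virtual[OF u(1,2)] closed by simp
    next
      assume w: "w \<noteq> [] \<and> w \<in> HW B U v (vsrc u)"
      then have "walk_degree B U w \<in> carrier G"
        by (intro X.walk_degree_closed) (auto simp: HW_def walks_def)
      with w u(3) virtual[OF u(1,2)] closed Cons.IH[of "vsrc u"] show ?thesis
        by (simp add: Y.X.m_assoc[symmetric]) (simp add: Y.X.m_assoc)
    qed
  qed
qed

text \<open>
  The group generated by \<open>t\<close> is free, so \<open>t\<close> may be sent to any element.
\<close>

lemma power_hom:
  assumes "group H" "m \<in> carrier H"
  obtains mu where "mu \<in> hom G H" "mu \<in> extensional (carrier G)" "mu t = m"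
proof -
  interpret H: group H by fact
  define mu where "mu = (\<lambda>s\<in>carrier G. m [^]\<^bsub>H\<^esub> (the_inv (\<lambda>k :: int. t [^]\<^bsub>G\<^esub> k) s))"
  have mu: "mu (t [^]\<^bsub>G\<^esub> k) = m [^]\<^bsub>H\<^esub> k" for k :: int
    using the_inv_f_f[OF powers_inj, of k] by (simp add: mu_def)
  show thesis
  proof
    show "mu \<in> hom G H"
    proof (rule homI)
      show "mu s \<in> carrier H" if "s \<in> carrier G" for s
        using that mu assms(2) powers by auto
      show "mu (s \<otimes>\<^bsub>G\<^esub> s') = mu s \<otimes>\<^bsub>H\<^esub> mu s'" if s: "s \<in> carrier G" "s' \<in> carrier G" for s s'
      proof -
        obtain k k' :: int where "s = t [^]\<^bsub>G\<^esub> k" "s' = t [^]\<^bsub>G\<^esub> k'" using s powers by auto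
        then show ?thesis
          using mu assms(2) by (simp add: X.int_pow_mult[symmetric] H.int_pow_mult[symmetric])
      qed
    qed
    show "mu \<in> extensional (carrier G)" by (simp add: mu_def)
    show "mu t = m" using mu[of 1] assms(2) X.int_pow_1[OF t_closed] H.int_pow_1[of m] by simp
  qed
qed

lemma universal: "universal_grading TYPE('g) K B Vx U"
  unfolding universal_grading_def
proof (intro conjI connected allI impI)
  fix Y :: "('g, vertex, 'm) grading"
  assume "connected_k_grading K B Y"
  then have kY: "k_grading K B Y" by (rule connected_k_grading.axioms)
  obtain a b c d where "graded_triangle K B al be ga de Y a b c d"
    by (rule generators_homogeneous[OF kY])
      (blast intro: graded_triangle.intro graded_triangle_axioms.intro triangle_with_tail_axioms kY)
  then interpret Y: graded_triangle K B al be ga de Y a b c d .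
  let ?loop = "[(Vx, Vy, al, -1), (Vy, Vz, be, -1), (Vx, Vz, ga, 1)]"
  have id: "k_automorphism K B (\<lambda>_ _ f. f)"
    by (intro k_automorphism.intro k_category_axioms k_automorphism_axioms.intro) (simp_all add: bij_betw_def)
  have map_id: "map_walk (\<lambda>_ _ f. f) w = w" for w :: "(vertex, 'm) vmor list"
    by (simp add: map_walk_def case_prod_beta)
  have "homogeneous B U Vx Vy al" "homogeneous B U Vy Vz be" "homogeneous B U Vx Vz ga"
    using X.homogeneousI[OF al_deg] X.homogeneousI[OF be_deg] X.homogeneousI[OF ga_deg]
      generators_nonzero ga_nonzero by blast+
  then have loop_HW: "?loop \<in> HW B U Vx Vx"
    using al_closed be_closed ga_closed generators_nonzero ga_nonzero
    by (auto simp: HW_def walks_def)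
  \<comment> \<open>The potential of the universal grading is trivial, so the degree of the loop is that of \<open>ga\<close>.\<close>
  have loop_U: "walk_degree B U ?loop = t"
    using loop_degree[OF id] by (simp add: map_id twist_def)
  show "\<exists>!mu. mu \<in> extensional (carrier G) \<and> grading_morphism K B Vx U Y mu"
  proof (rule ex_ex1I)
    \<comment> \<open>Existence: the generator goes to the degree of the loop in \<open>Y\<close>.\<close>
    obtain mu where mu: "mu \<in> hom G Y.G" "mu \<in> extensional (carrier G)" "mu t = Y.twist"
      using power_hom[OF Y.X.group_axioms Y.twist_closed] by blast
    have "homogeneous B Y v v' f" if f: "homogeneous B U v v' f" for v v' f
    proof -
      have "f \<noteq> \<zero>\<^bsub>homs B v v'\<^esub>"
        using f by (auto simp: homogeneous_def homogeneous_of_degree_def)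
      with homogeneous_cases[OF f] Y.base_part_piece[of f v v'] Y.twist_part_piece[of f v v'] show ?thesis
        by (auto intro: Y.X.homogeneousI[rotated])
    qed
    then have "homogeneous_automorphism K B U Y (\<lambda>_ _ f. f)"
      using id by (simp add: homogeneous_automorphism_def)
    moreover have "mu (walk_degree B U w) = walk_degree B Y (map_walk (\<lambda>_ _ f. f) w)" if w: "w \<in> HW B U Vx Vx" for w
    proof -
      have "walk_degree B U w \<in> carrier G"
        using w by (intro X.walk_degree_closed) (auto simp: HW_def walks_def)
      then have "mu (walk_degree B U w) \<in> carrier Y.G" using mu(1) by (auto simp: hom_def)
      then show ?thesis
        using walk_degree_telescope[OF Y.graded_triangle_axioms mu(1,3) w]
        by (simp add: map_id) (simp add: Y.pot_def)
    qed
    ultimately have "grading_morphism K B Vx U Y mu"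
      unfolding grading_morphism_def using mu(1) by blast
    with mu(2) show "\<exists>mu. mu \<in> extensional (carrier G) \<and> grading_morphism K B Vx U Y mu" by blast
  next
    \<comment> \<open>Uniqueness: whichever automorphism is used, the loop determines the image of the generator.\<close>
    have hom: "mu \<in> hom G Y.G" and mu_t: "mu t = Y.twist" if mu: "grading_morphism K B Vx U Y mu" for mu
    proof -
      obtain J where J: "homogeneous_automorphism K B U Y J"
        "\<forall>w\<in>HW B U Vx Vx. mu (walk_degree B U w) = walk_degree B Y (map_walk J w)"
        using mu unfolding grading_morphism_def by blast
      have "k_automorphism K B J" using J(1) by (simp add: homogeneous_automorphism_def)
      from Y.loop_degree[OF this] J(2)[rule_format, OF loop_HW] loop_U show "mu t = Y.twist" by simp
      show "mu \<in> hom G Y.G" using mu by (simp add: grading_morphism_def)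
    qed
    fix mu mu'
    assume mu: "mu \<in> extensional (carrier G) \<and> grading_morphism K B Vx U Y mu"
      and mu': "mu' \<in> extensional (carrier G) \<and> grading_morphism K B Vx U Y mu'"
    have pow: "nu (t [^]\<^bsub>G\<^esub> k) = Y.twist [^]\<^bsub>Y.G\<^esub> k" if "grading_morphism K B Vx U Y nu" for nu and k :: int
      using hom_int_pow[OF hom[OF that] t_closed X.group_axioms Y.X.group_axioms] mu_t[OF that] by simp
    have "mu s = mu' s" if s: "s \<in> carrier G" for s
    proof -
      obtain k :: int where "s = t [^]\<^bsub>G\<^esub> k" using s powers by auto
      then show ?thesis using pow[of mu k] pow[of mu' k] mu mu' by simp
    qed
    then show "mu = mu'"
      using mu mu' by (intro extensionalityI[where A = "carrier G"]) blast+
  qed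
qed

end

section \<open>The categories of the theorem\<close>

lemma wf_digraph_Qv: "wf_digraph Qv"
  by unfold_locales (simp_all add: Qv_def)

lemma verts_Qv [simp]: "verts Qv = UNIV"
  by (simp add: Qv_def)

lemma awalk_Qv_Cons:
  "pre_digraph.awalk Qv u (e # p) v
    \<longleftrightarrow> u = tail Qv e \<and> pre_digraph.awalk Qv (head Qv e) p v"
  using wf_digraph.awalk_Cons_iff[OF wf_digraph_Qv] by (simp add: Qv_def)

lemma awalk_Qv_Nil: "pre_digraph.awalk Qv u [] v \<longleftrightarrow> u = v"
  using wf_digraph.awalk_Nil_iff[OF wf_digraph_Qv] by simp

lemma tail_head_Qv:
  "tail Qv Alpha = Vx" "head Qv Alpha = Vy" "tail Qv Beta = Vy" "head Qv Beta = Vz"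
  "tail Qv Gamma = Vx" "head Qv Gamma = Vz" "tail Qv Delta = Vz" "head Qv Delta = Vz'"
  by (simp_all add: Qv_def)

lemma awalk_Qv_iff:
  "pre_digraph.awalk Qv Vz' p v \<longleftrightarrow> (p, v) = ([], Vz')"
  "pre_digraph.awalk Qv Vz p v \<longleftrightarrow> (p, v) \<in> {([], Vz), ([Delta], Vz')}"
  "pre_digraph.awalk Qv Vy p v \<longleftrightarrow> (p, v) \<in> {([], Vy), ([Beta], Vz), ([Beta, Delta], Vz')}"
  "pre_digraph.awalk Qv Vx p v \<longleftrightarrow> (p, v) \<in> {([], Vx), ([Alpha], Vy), ([Gamma], Vz),
     ([Alpha, Beta], Vz), ([Gamma, Delta], Vz'), ([Alpha, Beta, Delta], Vz')}"
proof -
  have cons: "pre_digraph.awalk Qv u p v \<longleftrightarrow> (p = [] \<and> u = v) \<or>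
      (\<exists>e r. p = e # r \<and> u = tail Qv e \<and> pre_digraph.awalk Qv (head Qv e) r v)" for u p v
    by (cases p) (simp_all add: awalk_Qv_Cons awalk_Qv_Nil)
  have arrow: "(\<exists>e. P e) \<longleftrightarrow> P Alpha \<or> P Beta \<or> P Gamma \<or> P Delta" for P
    by (metis arrow.exhaust)
  show z': "pre_digraph.awalk Qv Vz' p v \<longleftrightarrow> (p, v) = ([], Vz')" for p v
    by (subst cons) (auto simp: arrow tail_head_Qv)
  show z: "pre_digraph.awalk Qv Vz p v \<longleftrightarrow> (p, v) \<in> {([], Vz), ([Delta], Vz')}" for p v
    by (subst cons) (auto simp: arrow tail_head_Qv z')
  show y: "pre_digraph.awalk Qv Vy p v \<longleftrightarrow> (p, v) \<in> {([], Vy), ([Beta], Vz), ([Beta, Delta], Vz')}" for p v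
    by (subst cons) (auto simp: arrow tail_head_Qv z)
  show "pre_digraph.awalk Qv Vx p v \<longleftrightarrow> (p, v) \<in> {([], Vx), ([Alpha], Vy), ([Gamma], Vz),
     ([Alpha, Beta], Vz), ([Gamma, Delta], Vz'), ([Alpha, Beta, Delta], Vz')}"
    by (subst cons) (auto simp: arrow tail_head_Qv z y)
qed

lemma paths_Qv:
  "paths Qv Vx Vx = {[]}" "paths Qv Vx Vy = {[Alpha]}" "paths Qv Vx Vz = {[Gamma], [Alpha, Beta]}"
  "paths Qv Vx Vz' = {[Gamma, Delta], [Alpha, Beta, Delta]}"
  "paths Qv Vy Vx = {}" "paths Qv Vy Vy = {[]}" "paths Qv Vy Vz = {[Beta]}" "paths Qv Vy Vz' = {[Beta, Delta]}"
  "paths Qv Vz Vx = {}" "paths Qv Vz Vy = {}" "paths Qv Vz Vz = {[]}" "paths Qv Vz Vz' = {[Delta]}"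
  "paths Qv Vz' Vx = {}" "paths Qv Vz' Vy = {}" "paths Qv Vz' Vz = {}" "paths Qv Vz' Vz' = {[]}"
  by (auto simp: paths_def awalk_Qv_iff)

lemma path_kcat_no_path:
  assumes "paths Q b b' = {}" "f \<in> carrier (homs (path_kcat K Q) b b')"
  shows "f = \<zero>\<^bsub>homs (path_kcat K Q) b b'\<^esub>"
  using path_kcat_carrierD(3)[OF assms(2)] assms(1) by auto

lemma path_kcat_one_path:
  fixes K :: "('k, 'c) ring_scheme" (structure)
  assumes "cring K" "paths Q b b' = {p}" "f \<in> carrier (homs (path_kcat K Q) b b')"
  shows "f = f p \<odot>\<^bsub>homs (path_kcat K Q) b b'\<^esub> path_vec K p"
proof -
  interpret cring K by fact
  show ?thesis
    using path_kcat_carrierD(1,3)[OF assms(3)] assms(2) by (intro ext) (auto simp: path_vec_def)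
qed

definition tail_relation :: "('k, 'c) ring_scheme \<Rightarrow> 'k \<Rightarrow> arrow list \<Rightarrow> 'k" where
  "tail_relation K q = path_vec K [Gamma, Delta]
    \<ominus>\<^bsub>homs (path_kcat K Qv) Vx Vz'\<^esub> q \<odot>\<^bsub>homs (path_kcat K Qv) Vx Vz'\<^esub> path_vec K [Alpha, Beta, Delta]"

context
  fixes K :: "('k, 'c) ring_scheme" (structure) and q :: 'k
  assumes field: "field K" and q: "q \<in> carrier K"
begin

interpretation field K by (rule field)
interpretation P: k_category K "path_kcat K Qv"
  by (rule k_category_path_kcat[OF field wf_digraph_Qv])

lemma path_vec_Qv_closed: "p \<in> paths Qv b b' \<Longrightarrow> path_vec K p \<in> carrier (homs (path_kcat K Qv) b b')"
  by (rule path_vec_closed[OF cring_axioms])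

lemma linear_space_paths: "linear_space K (homs (path_kcat K Qv) b b')"
  by (rule P.hom_space) simp_all

lemma I_rel_eq:
  "I_rel K q b b' = (if b = Vx \<and> b' = Vz' then linear_space.line K (homs (path_kcat K Qv) Vx Vz') (tail_relation K q)
    else {\<zero>\<^bsub>homs (path_kcat K Qv) b b'\<^esub>})"
  by (auto simp: I_rel_def Let_def tail_relation_def linear_space.line_def[OF linear_space_paths])

lemma tail_relation_closed: "tail_relation K q \<in> carrier (homs (path_kcat K Qv) Vx Vz')"
proof -
  interpret M: linear_space K "homs (path_kcat K Qv) Vx Vz'" by (rule linear_space_paths)
  show ?thesis
    unfolding tail_relation_def
    by (intro M.M.minus_closed M.smult_closed q path_vec_Qv_closed) (simp_all add: paths_Qv)
qed

lemma I_rel_submodule: "submodule (I_rel K q b b') K (homs (path_kcat K Qv) b b')"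
proof -
  interpret M: linear_space K "homs (path_kcat K Qv) b b'" by (rule linear_space_paths)
  have "submodule {\<zero>\<^bsub>homs (path_kcat K Qv) b b'\<^esub>} K (homs (path_kcat K Qv) b b')"
    by (rule M.submoduleI) (use M.M.zero_closed in \<open>auto simp del: path_kcat_sel\<close>)
  then show ?thesis
    using M.line_submodule tail_relation_closed
    by (cases "b = Vx \<and> b' = Vz'") (auto simp: I_rel_eq simp del: path_kcat_sel)
qed

lemma loop_is_scalar:
  assumes "f \<in> carrier (homs (path_kcat K Qv) b b)"
  obtains c where "c \<in> carrier K" "f = c \<odot>\<^bsub>homs (path_kcat K Qv) b b\<^esub> idm (path_kcat K Qv) b"
proof -
  have "paths Qv b b = {[]}" by (cases b) (simp_all add: paths_Qv)
  from path_kcat_one_path[OF cring_axioms this assms] path_kcat_carrierD(1)[OF assms] show thesis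
    by (intro that[of "f []"]) simp_all
qed

text \<open>
  The relation goes from \<open>x\<close> to \<open>z'\<close>. No path leads into \<open>x\<close> or out of \<open>z'\<close> except for the trivial ones, so
  composing it with another morphism gives a scalar multiple of it, or zero.
\<close>

lemma two_sided_ideal_I_rel: "two_sided_ideal K (path_kcat K Qv) (I_rel K q)"
proof (intro two_sided_ideal.intro P.k_category_axioms two_sided_ideal_axioms.intro I_rel_submodule)
  note [simp del] = path_kcat_sel(2-)
  fix b b' b'' f g
  have zero: "\<zero>\<^bsub>homs (path_kcat K Qv) b b''\<^esub> \<in> I_rel K q b b''"
    by (rule linear_space.submodule_zero[OF linear_space_paths I_rel_submodule])
  have closed: "h \<in> carrier (homs (path_kcat K Qv) v v')" if "h \<in> I_rel K q v v'" for h v v'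
    by (rule linear_space.submodule_closed[OF linear_space_paths I_rel_submodule that])
  show "cmp (path_kcat K Qv) b b' b'' g f \<in> I_rel K q b b''"
    if g: "g \<in> carrier (homs (path_kcat K Qv) b' b'')" and f: "f \<in> I_rel K q b b'"
  proof -
    consider "f = \<zero>\<^bsub>homs (path_kcat K Qv) b b'\<^esub>" | "b' = Vz'" "b'' \<noteq> Vz'" | "b' = Vz'" "b'' = Vz'"
      using f by (auto simp: I_rel_eq split: if_splits)
    then show ?thesis
    proof cases
      case 1
      then show ?thesis using zero g by simp
    next
      case 2
      then have "g = \<zero>\<^bsub>homs (path_kcat K Qv) b' b''\<^esub>"
        using path_kcat_no_path[OF _ g] by (cases b'') (simp_all add: paths_Qv)
      then show ?thesis using zero closed[OF f] by simp
    next
      case 3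
      then obtain c where c: "c \<in> carrier K" "g = c \<odot>\<^bsub>homs (path_kcat K Qv) Vz' Vz'\<^esub> idm (path_kcat K Qv) Vz'"
        using g loop_is_scalar by blast
      have "cmp (path_kcat K Qv) b b' b'' g f = c \<odot>\<^bsub>homs (path_kcat K Qv) b Vz'\<^esub> f"
        using closed[OF f] c 3 P.idm_closed[of Vz'] by (simp add: P.cmp_smult_left P.cmp_idm_left)
      then show ?thesis
        using 3 f c submodule.smult_closed[OF I_rel_submodule] by simp
    qed
  qed
  show "cmp (path_kcat K Qv) b b' b'' g f \<in> I_rel K q b b''"
    if g: "g \<in> I_rel K q b' b''" and f: "f \<in> carrier (homs (path_kcat K Qv) b b')"
  proof -
    consider "g = \<zero>\<^bsub>homs (path_kcat K Qv) b' b''\<^esub>" | "b' = Vx" "b \<noteq> Vx" | "b' = Vx" "b = Vx"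
      using g by (auto simp: I_rel_eq split: if_splits)
    then show ?thesis
    proof cases
      case 1
      then show ?thesis using zero f by simp
    next
      case 2
      then have "f = \<zero>\<^bsub>homs (path_kcat K Qv) b b'\<^esub>"
        using path_kcat_no_path[OF _ f] by (cases b) (simp_all add: paths_Qv)
      then show ?thesis using zero closed[OF g] by simp
    next
      case 3
      then obtain c where c: "c \<in> carrier K" "f = c \<odot>\<^bsub>homs (path_kcat K Qv) Vx Vx\<^esub> idm (path_kcat K Qv) Vx"
        using f loop_is_scalar by blast
      have "cmp (path_kcat K Qv) b b' b'' g f = c \<odot>\<^bsub>homs (path_kcat K Qv) Vx b''\<^esub> g"
        using closed[OF g] c 3 P.idm_closed[of Vx] by (simp add: P.cmp_smult_right P.cmp_idm_right)
      then show ?thesis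
        using 3 g c submodule.smult_closed[OF I_rel_submodule] by simp
    qed
  qed
qed

interpretation I: two_sided_ideal K "path_kcat K Qv" "I_rel K q"
  by (rule two_sided_ideal_I_rel)

interpretation B: k_category K "B_cat K q"
  unfolding B_cat_def by (rule I.k_category_quot)

lemma objs_B_cat: "objs (B_cat K q) = UNIV"
  by (simp add: B_cat_def)

lemma linear_space_B_cat: "linear_space K (homs (B_cat K q) b b')"
  by (rule B.hom_space) (simp_all add: objs_B_cat)

lemma module_B_cat: "Module.module K (homs (B_cat K q) b b')"
  by (rule B.homs_module) (simp_all add: objs_B_cat)

lemma cls_simps:
  fixes b b' :: vertex
  assumes f: "f \<in> carrier (homs (path_kcat K Qv) b b')"
  shows "I.cls b b' f \<in> carrier (homs (B_cat K q) b b')"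
    and "c \<in> carrier K \<Longrightarrow> I.cls b b' (c \<odot>\<^bsub>homs (path_kcat K Qv) b b'\<^esub> f) = c \<odot>\<^bsub>homs (B_cat K q) b b'\<^esub> I.cls b b' f"
    and "g \<in> carrier (homs (path_kcat K Qv) b b') \<Longrightarrow>
      I.cls b b' (f \<oplus>\<^bsub>homs (path_kcat K Qv) b b'\<^esub> g) = I.cls b b' f \<oplus>\<^bsub>homs (B_cat K q) b b'\<^esub> I.cls b b' g"
    and "I.cls b b' f = \<zero>\<^bsub>homs (B_cat K q) b b'\<^esub> \<longleftrightarrow> f \<in> I_rel K q b b'"
  unfolding B_cat_def using f I.cls_smult[of b b' c f] I.cls_add[of b b' f g] I.cls_eq_zero_iff[of b b' f]
  by (simp_all add: I.quot_carrier del: path_kcat_sel(2-))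

lemma cls_surj:
  assumes "F \<in> carrier (homs (B_cat K q) b b')"
  obtains f where "f \<in> carrier (homs (path_kcat K Qv) b b')" "F = I.cls b b' f"
  using assms unfolding B_cat_def I.quot_carrier by blast

lemma cls_path_cmp:
  assumes "p \<in> paths Qv b b'" "r \<in> paths Qv b' b''"
  shows "cmp (B_cat K q) b b' b'' (I.cls b' b'' (path_vec K r)) (I.cls b b' (path_vec K p))
    = I.cls b b'' (path_vec K (p @ r))"
  unfolding B_cat_def using I.cls_cmp[of b b' b''] path_vec_Qv_closed assms
  by (simp add: cmp_path_vec_path_vec[OF cring_axioms])

lemma hom_one_path:
  assumes "paths Qv b b' = {p}"
  shows "carrier (homs (B_cat K q) b b') = B.hom_line b b' (I.cls b b' (path_vec K p))"
proof
  have p: "path_vec K p \<in> carrier (homs (path_kcat K Qv) b b')"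
    using assms by (intro path_vec_Qv_closed) simp
  show "B.hom_line b b' (I.cls b b' (path_vec K p)) \<subseteq> carrier (homs (B_cat K q) b b')"
    using linear_space.line_submodule[OF linear_space_B_cat cls_simps(1)[OF p]]
      linear_space.submodule_closed[OF linear_space_B_cat] by blast
  show "carrier (homs (B_cat K q) b b') \<subseteq> B.hom_line b b' (I.cls b b' (path_vec K p))"
  proof
    fix F assume "F \<in> carrier (homs (B_cat K q) b b')"
    then obtain f where f: "f \<in> carrier (homs (path_kcat K Qv) b b')" "F = I.cls b b' f"
      by (rule cls_surj)
    have "F = f p \<odot>\<^bsub>homs (B_cat K q) b b'\<^esub> I.cls b b' (path_vec K p)"
      unfolding f(2) using cls_simps(2)[OF p, of "f p"] path_kcat_carrierD(1)[OF f(1)]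
        path_kcat_one_path[OF cring_axioms assms f(1)] by simp
    then show "F \<in> B.hom_line b b' (I.cls b b' (path_vec K p))"
      using path_kcat_carrierD(1)[OF f(1)] by (auto simp: linear_space.line_def[OF linear_space_B_cat])
  qed
qed

abbreviation gamma_twisted where
  "gamma_twisted \<equiv> path_vec K [Gamma] \<oplus>\<^bsub>homs (path_kcat K Qv) Vx Vz\<^esub>
    (\<ominus> q) \<odot>\<^bsub>homs (path_kcat K Qv) Vx Vz\<^esub> path_vec K [Alpha, Beta]"

lemma tail_relation_eq:
  "tail_relation K q = path_vec K [Gamma, Delta] \<oplus>\<^bsub>homs (path_kcat K Qv) Vx Vz'\<^esub>
    (\<ominus> q) \<odot>\<^bsub>homs (path_kcat K Qv) Vx Vz'\<^esub> path_vec K [Alpha, Beta, Delta]"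
proof -
  interpret M: linear_space K "homs (path_kcat K Qv) Vx Vz'" by (rule linear_space_paths)
  show ?thesis
    unfolding tail_relation_def a_minus_def
    using q by (subst M.smult_l_minus) (simp_all add: path_vec_Qv_closed paths_Qv del: path_kcat_sel(2-))
qed

lemma gamma_twisted_closed: "gamma_twisted \<in> carrier (homs (path_kcat K Qv) Vx Vz)"
proof -
  interpret M: linear_space K "homs (path_kcat K Qv) Vx Vz" by (rule linear_space_paths)
  show ?thesis
    using q by (intro M.M.a_closed M.smult_closed path_vec_Qv_closed) (simp_all add: paths_Qv)
qed

lemma arrow_mor_cls:
  "arrow_mor K q Alpha = I.cls Vx Vy (path_vec K [Alpha])"
  "arrow_mor K q Beta = I.cls Vy Vz (path_vec K [Beta])"
  "arrow_mor K q Gamma = I.cls Vx Vz (path_vec K [Gamma])"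
  "arrow_mor K q Delta = I.cls Vz Vz' (path_vec K [Delta])"
  by (simp_all add: arrow_mor_def I.cls_def tail_head_Qv)

lemma gamma_twisted_cls:
  "arrow_mor K q Gamma \<ominus>\<^bsub>homs (B_cat K q) Vx Vz\<^esub> q \<odot>\<^bsub>homs (B_cat K q) Vx Vz\<^esub>
      cmp (B_cat K q) Vx Vy Vz (arrow_mor K q Beta) (arrow_mor K q Alpha) = I.cls Vx Vz gamma_twisted"
proof -
  interpret M: linear_space K "homs (B_cat K q) Vx Vz" by (rule linear_space_B_cat)
  have closed: "path_vec K [Gamma] \<in> carrier (homs (path_kcat K Qv) Vx Vz)"
    "path_vec K [Alpha, Beta] \<in> carrier (homs (path_kcat K Qv) Vx Vz)"
    by (simp_all add: path_vec_Qv_closed paths_Qv)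
  have "cmp (B_cat K q) Vx Vy Vz (arrow_mor K q Beta) (arrow_mor K q Alpha) = I.cls Vx Vz (path_vec K [Alpha, Beta])"
    using cls_path_cmp[of "[Alpha]" Vx Vy "[Beta]" Vz] by (simp add: arrow_mor_cls paths_Qv)
  moreover have "(\<ominus> q) \<odot>\<^bsub>homs (path_kcat K Qv) Vx Vz\<^esub> path_vec K [Alpha, Beta] \<in> carrier (homs (path_kcat K Qv) Vx Vz)"
    using module.smult_closed[OF linear_space.axioms(1)[OF linear_space_paths] _ closed(2)] q by simp
  ultimately show ?thesis
    using q cls_simps(1)[OF closed(2)] cls_simps(2)[OF closed(2), of "\<ominus> q"]
    by (simp add: arrow_mor_cls(3) cls_simps(3)[OF closed(1)] a_minus_def M.smult_l_minus del: path_kcat_sel(2-))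
qed

text \<open>
  All claims are read off from the lists of paths, except for those that involve the relation
  \<open>\<delta>\<gamma> - q\<delta>\<beta>\<alpha>\<close>. It makes \<open>\<delta>\<beta>\<alpha>\<close> span the morphisms from \<open>x\<close> to \<open>z'\<close>, and it is the composite of
  \<open>\<gamma> - q\<beta>\<alpha>\<close> with \<open>\<delta>\<close>. The class of \<open>\<delta>\<beta>\<alpha>\<close> does not vanish: a multiple of the relation without a
  \<open>\<delta>\<gamma>\<close> term is zero.
\<close>

lemma triangle_with_tail_B_cat:
  "triangle_with_tail K (B_cat K q) (arrow_mor K q Alpha) (arrow_mor K q Beta)
    (arrow_mor K q Gamma \<ominus>\<^bsub>homs (B_cat K q) Vx Vz\<^esub> q \<odot>\<^bsub>homs (B_cat K q) Vx Vz\<^esub>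
      cmp (B_cat K q) Vx Vy Vz (arrow_mor K q Beta) (arrow_mor K q Alpha))
    (arrow_mor K q Delta)"
proof -
  note [simp del] = path_kcat_sel(2-)
  have ba: "cmp (B_cat K q) Vx Vy Vz (arrow_mor K q Beta) (arrow_mor K q Alpha)
      = I.cls Vx Vz (path_vec K [Alpha, Beta])"
    using cls_path_cmp[of "[Alpha]" Vx Vy "[Beta]" Vz] by (simp add: arrow_mor_cls paths_Qv)
  have db: "cmp (B_cat K q) Vy Vz Vz' (arrow_mor K q Delta) (arrow_mor K q Beta)
      = I.cls Vy Vz' (path_vec K [Beta, Delta])"
    using cls_path_cmp[of "[Beta]" Vy Vz "[Delta]" Vz'] by (simp add: arrow_mor_cls paths_Qv)
  have dba: "cmp (B_cat K q) Vx Vz Vz' (arrow_mor K q Delta) (I.cls Vx Vz (path_vec K [Alpha, Beta]))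
      = I.cls Vx Vz' (path_vec K [Alpha, Beta, Delta])"
    using cls_path_cmp[of "[Alpha, Beta]" Vx Vz "[Delta]" Vz'] by (simp add: arrow_mor_cls paths_Qv)
  have vec: "path_vec K p \<in> carrier (homs (path_kcat K Qv) b b')" if "p \<in> paths Qv b b'" for p b b'
    by (rule path_vec_Qv_closed[OF that])
  have ABD: "path_vec K [Alpha, Beta, Delta] \<in> carrier (homs (path_kcat K Qv) Vx Vz')"
    and AB: "path_vec K [Alpha, Beta] \<in> carrier (homs (path_kcat K Qv) Vx Vz)"
    by (simp_all add: vec paths_Qv)
  have smult: "c \<odot>\<^bsub>homs (path_kcat K Qv) b b'\<^esub> f \<in> carrier (homs (path_kcat K Qv) b b')"
    if "c \<in> carrier K" "f \<in> carrier (homs (path_kcat K Qv) b b')" for b b' c f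
    using module.smult_closed[OF linear_space.axioms(1)[OF linear_space_paths]] that .
  have one_zero: "\<one> \<noteq> \<zero>" by simp
  show ?thesis
    unfolding gamma_twisted_cls
  proof (intro triangle_with_tail.intro B.k_category_axioms triangle_with_tail_axioms.intro objs_B_cat,
      unfold ba, unfold db dba, unfold arrow_mor_cls)
    show "carrier (homs (B_cat K q) v v) = B.hom_line v v (idm (B_cat K q) v)" for v
    proof -
      have "idm (B_cat K q) v = I.cls v v (path_vec K [])"
        by (simp add: B_cat_def I.quot_idm path_kcat_sel(2))
      then show ?thesis using hom_one_path[of v v "[]"] by (cases v) (simp_all add: paths_Qv)
    qed
    show "carrier (homs (B_cat K q) Vx Vz') = B.hom_line Vx Vz' (I.cls Vx Vz' (path_vec K [Alpha, Beta, Delta]))"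
    proof
      show "B.hom_line Vx Vz' (I.cls Vx Vz' (path_vec K [Alpha, Beta, Delta])) \<subseteq> carrier (homs (B_cat K q) Vx Vz')"
        using linear_space.line_submodule[OF linear_space_B_cat cls_simps(1)[OF ABD]]
          linear_space.submodule_closed[OF linear_space_B_cat] by blast
      show "carrier (homs (B_cat K q) Vx Vz') \<subseteq> B.hom_line Vx Vz' (I.cls Vx Vz' (path_vec K [Alpha, Beta, Delta]))"
      proof
        fix F assume "F \<in> carrier (homs (B_cat K q) Vx Vz')"
        then obtain f where f: "f \<in> carrier (homs (path_kcat K Qv) Vx Vz')" "F = I.cls Vx Vz' f"
          by (rule cls_surj)
        note val = path_kcat_carrierD(1)[OF f(1)]
        \<comment> \<open>Modulo the relation, the path \<open>\<delta>\<gamma>\<close> counts as \<open>q\<close> times \<open>\<delta>\<beta>\<alpha>\<close>.\<close>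
        let ?c = "f [Gamma, Delta] \<otimes> q \<oplus> f [Alpha, Beta, Delta]"
        have c: "?c \<in> carrier K" using val q by simp
        have "f = f [Gamma, Delta] \<odot>\<^bsub>homs (path_kcat K Qv) Vx Vz'\<^esub> tail_relation K q
            \<oplus>\<^bsub>homs (path_kcat K Qv) Vx Vz'\<^esub> ?c \<odot>\<^bsub>homs (path_kcat K Qv) Vx Vz'\<^esub> path_vec K [Alpha, Beta, Delta]"
          using path_kcat_carrierD(3)[OF f(1)] val q
          by (intro ext) (auto simp: tail_relation_eq path_kcat_sel path_vec_def paths_Qv r_minus r_neg1 r_neg2)
        moreover have "f [Gamma, Delta] \<odot>\<^bsub>homs (path_kcat K Qv) Vx Vz'\<^esub> tail_relation K q \<in> I_rel K q Vx Vz'"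
          using val by (auto simp: I_rel_eq linear_space.line_def[OF linear_space_paths])
        ultimately have "F = I.cls Vx Vz' (?c \<odot>\<^bsub>homs (path_kcat K Qv) Vx Vz'\<^esub> path_vec K [Alpha, Beta, Delta])"
          using I.cls_absorb[of Vx Vz'] smult[OF c ABD] f(2) by (metis path_kcat_sel(1) verts_Qv UNIV_I)
        then show "F \<in> B.hom_line Vx Vz' (I.cls Vx Vz' (path_vec K [Alpha, Beta, Delta]))"
          using c cls_simps(2)[OF ABD c] by (auto simp: linear_space.line_def[OF linear_space_B_cat])
      qed
    qed
    show "\<exists>c\<in>carrier K. \<exists>d\<in>carrier K. F = c \<odot>\<^bsub>homs (B_cat K q) Vx Vz\<^esub> I.cls Vx Vz (path_vec K [Alpha, Beta])
        \<oplus>\<^bsub>homs (B_cat K q) Vx Vz\<^esub> d \<odot>\<^bsub>homs (B_cat K q) Vx Vz\<^esub> I.cls Vx Vz gamma_twisted"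
      if F: "F \<in> carrier (homs (B_cat K q) Vx Vz)" for F
    proof -
      obtain f where f: "f \<in> carrier (homs (path_kcat K Qv) Vx Vz)" "F = I.cls Vx Vz f"
        using F by (rule cls_surj)
      note val = path_kcat_carrierD(1)[OF f(1)]
      \<comment> \<open>Substituting \<open>\<gamma> = (\<gamma> - q\<beta>\<alpha>) + q\<beta>\<alpha>\<close> gives the coordinates in the basis \<open>\<beta>\<alpha>\<close>, \<open>\<gamma> - q\<beta>\<alpha>\<close>.\<close>
      let ?c = "f [Gamma] \<otimes> q \<oplus> f [Alpha, Beta]"
      have c: "?c \<in> carrier K" using val q by simp
      have eq: "f = ?c \<odot>\<^bsub>homs (path_kcat K Qv) Vx Vz\<^esub> path_vec K [Alpha, Beta]
          \<oplus>\<^bsub>homs (path_kcat K Qv) Vx Vz\<^esub> f [Gamma] \<odot>\<^bsub>homs (path_kcat K Qv) Vx Vz\<^esub> gamma_twisted"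
        using path_kcat_carrierD(3)[OF f(1)] val q
        by (intro ext) (auto simp: path_kcat_sel path_vec_def paths_Qv r_minus a_ac r_neg r_neg1 r_neg2)
      have "F = ?c \<odot>\<^bsub>homs (B_cat K q) Vx Vz\<^esub> I.cls Vx Vz (path_vec K [Alpha, Beta])
        \<oplus>\<^bsub>homs (B_cat K q) Vx Vz\<^esub> f [Gamma] \<odot>\<^bsub>homs (B_cat K q) Vx Vz\<^esub> I.cls Vx Vz gamma_twisted"
        unfolding f(2) using val
        by (subst eq) (simp add: cls_simps(2)[OF AB c] cls_simps(2)[OF gamma_twisted_closed]
            cls_simps(3)[OF smult[OF c AB] smult[OF _ gamma_twisted_closed]])
      with c val show ?thesis by blast
    qed
    show "I.cls Vx Vz gamma_twisted \<noteq> \<zero>\<^bsub>homs (B_cat K q) Vx Vz\<^esub>"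
    proof
      assume "I.cls Vx Vz gamma_twisted = \<zero>\<^bsub>homs (B_cat K q) Vx Vz\<^esub>"
      then have "gamma_twisted = \<zero>\<^bsub>homs (path_kcat K Qv) Vx Vz\<^esub>"
        using cls_simps(4)[OF gamma_twisted_closed] by (simp add: I_rel_eq)
      from fun_cong[OF this, of "[Gamma]"] show False
        using q by (simp add: path_kcat_sel path_vec_def)
    qed
    show "cmp (B_cat K q) Vx Vz Vz' (I.cls Vz Vz' (path_vec K [Delta])) (I.cls Vx Vz gamma_twisted)
        = \<zero>\<^bsub>homs (B_cat K q) Vx Vz'\<^esub>"
    proof -
      have "cmp (path_kcat K Qv) Vx Vz Vz' (path_vec K [Delta]) gamma_twisted = tail_relation K q"
        using q vec[of "[Gamma]" Vx Vz] vec[of "[Delta]" Vz Vz'] AB smult[OF _ AB, of "\<ominus> q"]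
        by (simp add: P.cmp_add_right P.cmp_smult_right paths_Qv cmp_path_vec_path_vec[OF cring_axioms] tail_relation_eq)
      then have "cmp (B_cat K q) Vx Vz Vz' (I.cls Vz Vz' (path_vec K [Delta])) (I.cls Vx Vz gamma_twisted)
          = I.cls Vx Vz' (tail_relation K q)"
        using I.cls_cmp[of Vx Vz Vz'] vec[of "[Delta]" Vz Vz'] gamma_twisted_closed by (simp add: B_cat_def paths_Qv)
      also have "tail_relation K q \<in> I_rel K q Vx Vz'"
        using linear_space.line_self[OF linear_space_paths tail_relation_closed] by (simp add: I_rel_eq)
      then have "I.cls Vx Vz' (tail_relation K q) = \<zero>\<^bsub>homs (B_cat K q) Vx Vz'\<^esub>"
        using cls_simps(4)[OF tail_relation_closed] by simp
      finally show ?thesis .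
    qed
    show "I.cls Vx Vz' (path_vec K [Alpha, Beta, Delta]) \<noteq> \<zero>\<^bsub>homs (B_cat K q) Vx Vz'\<^esub>"
    proof
      assume "I.cls Vx Vz' (path_vec K [Alpha, Beta, Delta]) = \<zero>\<^bsub>homs (B_cat K q) Vx Vz'\<^esub>"
      then obtain c where c: "c \<in> carrier K"
        and eq: "path_vec K [Alpha, Beta, Delta] = c \<odot>\<^bsub>homs (path_kcat K Qv) Vx Vz'\<^esub> tail_relation K q"
        using cls_simps(4)[OF ABD] by (auto simp: I_rel_eq linear_space.line_def[OF linear_space_paths])
      from fun_cong[OF eq, of "[Gamma, Delta]"] have "c = \<zero>"
        using c q by (simp add: tail_relation_eq path_kcat_sel path_vec_def)
      with fun_cong[OF eq, of "[Alpha, Beta, Delta]"] show False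
        using q by (simp add: tail_relation_eq path_kcat_sel path_vec_def)
    qed
    show "carrier (homs (B_cat K q) b b') = {\<zero>\<^bsub>homs (B_cat K q) b b'\<^esub>}"
      if bb': "(b, b') \<in> {(Vy, Vx), (Vz, Vx), (Vz', Vx), (Vz, Vy), (Vz', Vy), (Vz', Vz)}" for b b'
    proof -
      have "F = \<zero>\<^bsub>homs (B_cat K q) b b'\<^esub>" if F: "F \<in> carrier (homs (B_cat K q) b b')" for F
      proof -
        obtain f where f: "f \<in> carrier (homs (path_kcat K Qv) b b')" "F = I.cls b b' f"
          using F by (rule cls_surj)
        have "paths Qv b b' = {}" using bb' by (auto simp: paths_Qv)
        from path_kcat_no_path[OF this f(1)] have "f \<in> I_rel K q b b'"
          using linear_space.submodule_zero[OF linear_space_paths I_rel_submodule] by simp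
        then show ?thesis using cls_simps(4)[OF f(1)] f(2) by simp
      qed
      moreover have "\<zero>\<^bsub>homs (B_cat K q) b b'\<^esub> \<in> carrier (homs (B_cat K q) b b')"
        using linear_space.submodule_zero[OF linear_space_B_cat module.carrier_is_submodule[OF module_B_cat]] .
      ultimately show ?thesis by blast
    qed
  qed (simp_all add: cls_simps(1) vec paths_Qv hom_one_path gamma_twisted_closed
      linear_space.line_self[OF linear_space_B_cat cls_simps(1)])
qed

end

theorem proposition32:
  fixes K :: "('k, 'c) ring_scheme" and q :: 'k
    and T :: "'t monoid" and t :: 't
  assumes "field K" and "q \<in> carrier K"
    and "group T" and "t \<in> carrier T" and "carrier T = generate T {t}" and "infinite (carrier T)"
  shows "(\<exists>U. special_grading K q T t U) \<and>
    (\<forall>U. special_grading K q T t U \<longrightarrow>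
       universal_grading TYPE('g) K (B_cat K q) Vx U)"
proof -
  interpret T: group T by fact
  define B where "B = B_cat K q"
  define ga where "ga = arrow_mor K q Gamma \<ominus>\<^bsub>homs B Vx Vz\<^esub> q \<odot>\<^bsub>homs B Vx Vz\<^esub>
      cmp B Vx Vy Vz (arrow_mor K q Beta) (arrow_mor K q Alpha)"
  interpret triangle_with_tail K B "arrow_mor K q Alpha" "arrow_mor K q Beta" ga "arrow_mor K q Delta"
    unfolding B_def ga_def using assms(1,2) by (rule triangle_with_tail_B_cat)
  have powers: "carrier T = range (\<lambda>k :: int. t [^]\<^bsub>T\<^esub> k)"
    using assms(5) T.generate_pow[OF assms(4)] by auto
  have inj: "inj (\<lambda>k :: int. t [^]\<^bsub>T\<^esub> k)"
    using T.infinite_cyclic_subgroup_int[OF assms(4)] assms(4-6) by (auto simp: inj_def subgroup_generated_def)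
  have special: "special_grading K q T t U \<longleftrightarrow> k_grading K B U \<and> sgroup U = T \<and>
      arrow_mor K q Alpha \<in> piece U \<one>\<^bsub>T\<^esub> Vx Vy \<and> arrow_mor K q Beta \<in> piece U \<one>\<^bsub>T\<^esub> Vy Vz \<and>
      arrow_mor K q Delta \<in> piece U \<one>\<^bsub>T\<^esub> Vz Vz' \<and> ga \<in> piece U t Vx Vz" for U
    unfolding special_grading_def Let_def homogeneous_of_degree_def B_def[symmetric] ga_def[symmetric]
    using generators_nonzero ga_nonzero assms(4) T.one_closed
    by (intro iffI; elim conjE; simp)
  have "t \<noteq> \<one>\<^bsub>T\<^esub>"
    using injD[OF inj, of 1 0] assms(4) by auto
  from grading_exists[OF assms(3,4) this] \<open>t \<noteq> \<one>\<^bsub>T\<^esub>\<close>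
  have "\<exists>U. special_grading K q T t U"
    unfolding special
    using linear_space.line_self[OF linear_space_homs ga_closed]
    by (intro exI conjI) (auto simp: base_part_def twist_part_def al_closed be_closed de_closed)
  moreover have "universal_grading TYPE('g) K B Vx U" if "special_grading K q T t U" for U
  proof -
    have "twisted_triangle K B (arrow_mor K q Alpha) (arrow_mor K q Beta) ga (arrow_mor K q Delta) U t"
      using that[unfolded special]
      by (intro twisted_triangle.intro graded_triangle.intro triangle_with_tail_axioms graded_triangle_axioms.intro
          twisted_triangle_axioms.intro) (simp_all add: assms(4) inj flip: powers)
    then show ?thesis by (rule twisted_triangle.universal)
  qed
  ultimately show ?thesis by (simp add: B_def)
qed

end
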